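(* Let $p\ge1$, let $X=X_1\,\dot\cup\,\cdots\,\dot\cup\,X_p$ be a finite set partitioned into nonempty blocks with $|X_i|=n_i$, let $a_1,\ldots,a_p$ be integers with $n_i>a_i\ge0$ for each $i\in[p]$, put $a=\sum_i a_i$, and let $k$ be an integer with $|X|\ge k\ge1$ and $k\ge a$. If \[ n_i\ge 3p(k-a+a_i)\qquad\text{for every } i\in[p], \] then every maximum intersecting subfamily of $\mathcal G(\boldsymbol a,k)$ is a full $1$-star of $\mathcal G(\boldsymbol a,k)$.
   Context: $\mathcal G(\boldsymbol a,k)=\{F\subseteq X: |F|=k,\ |F\cap X_i|\ge a_i\text{ for every }i\in[p]\}$, where $\boldsymbol a=(a_1,\ldots,a_p)$. A family is intersecting if any two of its members (including a member with itself) have nonempty intersection; "maximum" means of largest cardinality among intersecting subfamilies of $\mathcal G(\boldsymbol a,k)$. A full $1$-star of $\mathcal G(\boldsymbol a,k)$ is the family of all members of $\mathcal G(\boldsymbol a,k)$ containing a fixed element $x\in X$. *)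

theory Defs
  imports Main "HOL-Library.Disjoint_Sets"
begin

definition bounded_family ::
  "nat \<Rightarrow> (nat \<Rightarrow> 'a set) \<Rightarrow> (nat \<Rightarrow> nat) \<Rightarrow> nat \<Rightarrow> 'a set set" where
  "bounded_family p B a k =
    {F. F \<subseteq> (\<Union>i\<in>{1..p}. B i) \<and> card F = k \<and> (\<forall>i\<in>{1..p}. a i \<le> card (F \<inter> B i))}"

text \<open>The two members may coincide, so an intersecting family never contains the empty set.\<close>

definition intersecting :: "'a set set \<Rightarrow> bool" where
  "intersecting \<F> \<longleftrightarrow> (\<forall>A\<in>\<F>. \<forall>B\<in>\<F>. A \<inter> B \<noteq> {})"

text \<open>Largest in cardinality, not merely maximal under inclusion. Cardinalities are compared
  by \<^const>\<open>card\<close>, so this is meant for finite \<open>\<G>\<close>.\<close>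

definition maximum_intersecting :: "'a set set \<Rightarrow> 'a set set \<Rightarrow> bool" where
  "maximum_intersecting \<G> \<F> \<longleftrightarrow>
    \<F> \<subseteq> \<G> \<and> intersecting \<F> \<and>
    (\<forall>\<H>. \<H> \<subseteq> \<G> \<and> intersecting \<H> \<longrightarrow> card \<H> \<le> card \<F>)"

definition full_1_star :: "'a set \<Rightarrow> 'a set set \<Rightarrow> 'a set set \<Rightarrow> bool" where
  "full_1_star X \<G> \<F> \<longleftrightarrow> (\<exists>x\<in>X. \<F> = {F \<in> \<G>. x \<in> F})"

end

theory Submission
  imports Defs Complex_Main "HOL-Combinatorics.Permutations"
begin

text \<open>Split the members of the family by type, the vector of their block sizes; all block sizes \<open>k\<^sub>i\<close>
  satisfy \<open>3 p k\<^sub>i \<le> n\<^sub>i\<close>. In each block in turn, average over the cyclic orders of the block and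
  keep only the sets that trace an arc. Two cross-intersecting collections of arcs of lengths \<open>k\<close> and
  \<open>k'\<close> have at most \<open>k + k'\<close> members together. Hence, with a random threshold, the block can be replaced by
  one bit that is \<open>1\<close> with probability \<open>k\<^sub>i / n\<^sub>i\<close>, in such a way that the family stays intersecting and does
  not lose measure. After all blocks have been replaced there is an intersecting family of subsets of
  a \<open>p\<close>-element set, where element \<open>i\<close> has probability \<open>q\<^sub>i \<le> 1 / (3 p)\<close>. Branching along a minimum cover
  bounds its measure by \<open>\<Sum> \<theta>\<^sub>i q\<^sub>i\<close> with \<open>\<Sum> \<theta>\<^sub>i \<le> 1\<close> and \<open>\<theta>\<close> independent of the type; summing over the
  types gives at most the size of the largest star.

  If no singleton belongs to the family of bits, then \<open>\<Sum> \<theta>\<^sub>i \<le> 2/3\<close>. For uniqueness one may shift inside the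
  blocks, and for a shifted family that is not a star a suitable cyclic order and threshold make all
  singletons disappear.\<close>

section \<open>Intersecting families of random bits\<close>

text \<open>A single cutoff does not preserve the fraction f / n of arcs: cutoff \<kappa> loses
  every f with 0 < f < \<kappa>, while a tolerance r > 0 loses mass for f just above \<kappa>. Hence
  r is averaged. It is shared by all types, because sets of different types, with different arc
  lengths, must still intersect. The constant 3 leaves slack: the coefficients of a minimum cover of
  size m sum to m / 3^(m-1), which is at most 2/3 from m = 2 on, whereas with 2 in place of 3 the
  value at m = 2 would again be 1. So a loss fails to be visible only when a singleton bit set is
  present. Equality is therefore never analysed. The same upper bound holds on every branch of the
  averaging, so one cyclic order and one threshold per block for which all singletons vanish already
  make the bound strict. For p at least 2 these are the largest thresholds, with the low ranks
  placed far apart. The placement takes n_i \<ge> 6 b_i, where b_i bounds the block sizes, and the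
  hypothesis supplies this only from p = 2 on. For p = 1 it is replaced by Katona's cycle argument
  at threshold 0.\<close>

definition bits_weight :: "'a set \<Rightarrow> ('a \<Rightarrow> real) \<Rightarrow> 'a set \<Rightarrow> real" where
  "bits_weight R q b = (\<Prod>j\<in>R. if j \<in> b then q j else 1 - q j)"

lemma bits_weight_nonneg:
  assumes "\<And>j. j \<in> R \<Longrightarrow> 0 \<le> q j \<and> q j \<le> 1"
  shows "0 \<le> bits_weight R q b"
  unfolding bits_weight_def using assms by (intro prod_nonneg) auto

lemma sum_UN_le:
  fixes f :: "'a \<Rightarrow> real"
  assumes "finite I" "\<And>i. i \<in> I \<Longrightarrow> finite (A i)" "\<And>x. 0 \<le> f x"
  shows "sum f (\<Union>i\<in>I. A i) \<le> (\<Sum>i\<in>I. sum f (A i))"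
  using assms
proof (induction I)
  case (insert i I)
  have "sum f (A i \<union> (\<Union>i\<in>I. A i)) \<le> sum f (A i) + sum f (\<Union>i\<in>I. A i)"
    using insert by (subst sum_Un) (auto intro!: sum_nonneg)
  then show ?case using insert by force
qed simp

lemma sum_bits_weight_superset:
  assumes "finite R" "S \<subseteq> R"
  shows "(\<Sum>b | b \<subseteq> R \<and> S \<subseteq> b. bits_weight R q b) = prod q S"
proof -
  \<comment> \<open>The second summand is set to 0 on \<open>S\<close>, so that expanding the
    product over \<open>R\<close> keeps exactly the subsets containing \<open>S\<close>; off
    \<open>S\<close> the two summands add up to 1.\<close>
  define g where "g j = (if j \<in> S then 0 else 1 - q j)" for j
  have "(\<Prod>j\<in>R. q j + g j) = (\<Prod>j\<in>R. if j \<in> S then q j else 1)"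
    by (intro prod.cong) (auto simp: g_def)
  also have "\<dots> = prod q S"
    using assms by (simp add: prod.If_cases Int_absorb1 Collect_mem_eq)
  finally have 1: "prod q S = (\<Sum>X\<in>Pow R. prod q X * prod g (R - X))"
    using assms by (simp add: prod_add)
  have 2: "prod q X * prod g (R - X) = (if S \<subseteq> X then bits_weight R q X else 0)" if X: "X \<in> Pow R" for X
  proof (cases "S \<subseteq> X")
    case True
    have "bits_weight R q X = prod q X * (\<Prod>j\<in>R - X. 1 - q j)"
      using X assms finite_subset unfolding bits_weight_def
      by (subst prod.subset_diff[of X R]) (auto intro!: arg_cong2[where f = "(*)"] prod.cong simp: mult.commute)
    also have "(\<Prod>j\<in>R - X. 1 - q j) = prod g (R - X)"
      using True by (intro prod.cong) (auto simp: g_def)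
    finally show ?thesis using True by simp
  next
    case False
    then obtain j where "j \<in> S" "j \<notin> X" by auto
    then have "prod g (R - X) = 0" using assms
      by (intro prod_zero) (auto simp: g_def intro!: bexI[of _ j])
    then show ?thesis using False by simp
  qed
  have "prod q S = (\<Sum>X\<in>Pow R. if S \<subseteq> X then bits_weight R q X else 0)"
    unfolding 1 using 2 by (intro sum.cong) auto
  also have "\<dots> = (\<Sum>b | b \<subseteq> R \<and> S \<subseteq> b. bits_weight R q b)"
    using assms by (simp add: sum.If_cases) (rule sum.cong, auto)
  finally show ?thesis by simp
qed

text \<open>As long as \<open>S\<close> is not a cover, a member of \<open>\<B>\<close> containing \<open>S\<close> must use another element of some \<open>T\<close>
  disjoint from \<open>S\<close>, and all these elements together have probability at most \<open>1/3\<close>.\<close>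

lemma bits_branching:
  assumes R: "finite R" and \<B>: "\<B> \<subseteq> Pow R" "intersecting \<B>"
    and q: "\<And>j. j \<in> R \<Longrightarrow> 0 \<le> q j \<and> 3 * real (card R) * q j \<le> 1"
    and disj: "\<And>S. S \<subseteq> R \<Longrightarrow> card S < m \<Longrightarrow> \<exists>T\<in>\<B>. T \<inter> S = {}"
    and S: "S \<subseteq> R" "card S + t \<le> m"
  shows "(\<Sum>b | b \<in> \<B> \<and> S \<subseteq> b. bits_weight R q b) \<le> prod q S * (1/3) ^ t"
  using S
proof (induction t arbitrary: S)
  have q1: "0 \<le> q j \<and> q j \<le> 1" if "j \<in> R" for j
  proof -
    have "card R \<ge> 1" using that R by (metis One_nat_def Suc_leI card_gt_0_iff empty_iff)
    then have "q j * 1 \<le> q j * (3 * real (card R))" using q[OF that] by (intro mult_left_mono) auto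
    then show ?thesis using q[OF that] by (simp add: mult.commute)
  qed
  have nn: "0 \<le> bits_weight R q b" for b using q1 by (rule bits_weight_nonneg)
  {
    case (0 S)
    have "(\<Sum>b | b \<in> \<B> \<and> S \<subseteq> b. bits_weight R q b) \<le> (\<Sum>b | b \<subseteq> R \<and> S \<subseteq> b. bits_weight R q b)"
      using R \<B> nn by (intro sum_mono2) auto
    then show ?case using sum_bits_weight_superset[OF R 0(1)] by simp
  next
    case (Suc t S)
    then obtain T where T: "T \<in> \<B>" "T \<inter> S = {}" using disj[of S] by auto
    have fT: "T \<subseteq> R" "finite T" using T \<B> R by (auto intro: finite_subset)
    have fB: "finite \<B>" using \<B> R finite_subset by blast
    have "{b. b \<in> \<B> \<and> S \<subseteq> b} \<subseteq> (\<Union>j\<in>T. {b. b \<in> \<B> \<and> insert j S \<subseteq> b})"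
      using T(1) \<B>(2) by (force simp: intersecting_def)
    then have "(\<Sum>b | b \<in> \<B> \<and> S \<subseteq> b. bits_weight R q b)
        \<le> sum (bits_weight R q) (\<Union>j\<in>T. {b. b \<in> \<B> \<and> insert j S \<subseteq> b})"
      using fB fT nn by (intro sum_mono2) auto
    also have "\<dots> \<le> (\<Sum>j\<in>T. \<Sum>b | b \<in> \<B> \<and> insert j S \<subseteq> b. bits_weight R q b)"
      using fB fT nn by (intro sum_UN_le) auto
    also have "\<dots> \<le> (\<Sum>j\<in>T. (prod q S * (1/3) ^ t) * q j)"
    proof (rule sum_mono)
      fix j assume j: "j \<in> T"
      have "finite S" using Suc.prems R finite_subset by auto
      moreover have "j \<notin> S" using j T by auto
      ultimately show "(\<Sum>b | b \<in> \<B> \<and> insert j S \<subseteq> b. bits_weight R q b) \<le> (prod q S * (1/3) ^ t) * q j"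
        using Suc.IH[of "insert j S"] Suc.prems j fT by (auto simp: algebra_simps)
    qed
    also have "\<dots> = (prod q S * (1/3) ^ t) * (\<Sum>j\<in>T. q j)" by (simp add: sum_distrib_left)
    also have "\<dots> \<le> (prod q S * (1/3) ^ t) * (1/3)"
    proof (rule mult_left_mono)
      have "(\<Sum>j\<in>T. q j) \<le> (\<Sum>j\<in>R. q j)" using fT q R by (intro sum_mono2) auto
      also have "3 * real (card R) * (\<Sum>j\<in>R. q j) \<le> (\<Sum>j\<in>R. 1)"
        unfolding sum_distrib_left using q by (intro sum_mono) auto
      then have "3 * real (card R) * (\<Sum>j\<in>R. q j) \<le> real (card R)" by simp
      then have "(\<Sum>j\<in>R. q j) \<le> 1/3" using R
        by (cases "R = {}") (auto simp: field_simps card_gt_0_iff)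
      finally show "(\<Sum>j\<in>T. q j) \<le> 1/3" .
      show "0 \<le> prod q S * (1/3) ^ t" using Suc.prems q by (intro mult_nonneg_nonneg prod_nonneg) auto
    qed
    finally show ?case by simp
  }
qed

text \<open>These are the possible totals of \<open>\<theta>\<close> for a minimum cover of size
  \<open>m\<close>; from \<open>m = 2\<close> on the maximum 2/3 is attained at
  \<open>m = 2\<close>.\<close>

lemma of_nat_le_power3: "1 \<le> m \<Longrightarrow> real m * (1/3) ^ (m - 1) \<le> 1"
  and of_nat_le_power3': "2 \<le> m \<Longrightarrow> real m * (1/3) ^ (m - 1) \<le> 2/3"
proof -
  have *: "real m * (1/3) ^ (m - 1) \<le> 2/3" if "2 \<le> m" for m
  proof -
    define l where "l = m - 2"
    have l: "m = l + 2" using that by (simp add: l_def)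
    have "l + 2 \<le> 2 * 3 ^ l" by (induction l) auto
    then have "real (l + 2) \<le> 2 * 3 ^ l" by (simp only: of_nat_le_iff[symmetric, where ?'a = real]) simp
    then show ?thesis by (simp add: l power_divide field_simps)
  qed
  show "2 \<le> m \<Longrightarrow> real m * (1/3) ^ (m - 1) \<le> 2/3" by (rule *)
  show "1 \<le> m \<Longrightarrow> real m * (1/3) ^ (m - 1) \<le> 1" using *[of m] by (cases "m = 1") auto
qed

text \<open>The coefficients \<open>\<theta>\<close> do not depend on \<open>q\<close>: they are \<open>(1/3) ^ (m - 1)\<close> on a minimum cover of
  size \<open>m\<close>, with an extra factor \<open>1/3\<close> if \<open>m = 1\<close> and there is no singleton.\<close>

lemma intersecting_bits_bound:
  assumes R: "finite R" and \<B>: "\<B> \<subseteq> Pow R" "intersecting \<B>"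
  shows "\<exists>\<theta> :: 'a \<Rightarrow> real. (\<forall>j. 0 \<le> \<theta> j) \<and> sum \<theta> R \<le> 1 \<and>
    ((\<forall>j. {j} \<notin> \<B>) \<longrightarrow> sum \<theta> R \<le> 2/3) \<and>
    (\<forall>q. (\<forall>j\<in>R. 0 \<le> q j \<and> 3 * real (card R) * q j \<le> 1) \<longrightarrow>
       (\<Sum>b\<in>\<B>. bits_weight R q b) \<le> (\<Sum>j\<in>R. \<theta> j * q j))"
proof -
  define cover where "cover C \<longleftrightarrow> C \<subseteq> R \<and> (\<forall>b\<in>\<B>. b \<inter> C \<noteq> {})" for C
  define m where "m = (LEAST c. \<exists>C. cover C \<and> card C = c)"
  have "b \<inter> R \<noteq> {}" if "b \<in> \<B>" for b
  proof -
    have "b \<inter> b \<noteq> {}" using \<B>(2) that unfolding intersecting_def by blast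
    then show ?thesis using \<B>(1) that by blast
  qed
  then have "cover R" by (auto simp: cover_def)
  then have "\<exists>c C. cover C \<and> card C = c" by blast
  from LeastI_ex[OF this] have "\<exists>C. cover C \<and> card C = m" unfolding m_def .
  then obtain C where C: "cover C" "card C = m" by auto
  have CR: "C \<subseteq> R" "finite C" using C R finite_subset by (auto simp: cover_def)
  have disj: "\<exists>T\<in>\<B>. T \<inter> S = {}" if "S \<subseteq> R" "card S < m" for S
    using that not_less_Least[of "card S" "\<lambda>c. \<exists>C. cover C \<and> card C = c"]
    by (auto simp: m_def cover_def)
  have fB: "finite \<B>" using \<B> R finite_subset by blast
  define s where "s = (if m = 1 \<and> (\<forall>j. {j} \<notin> \<B>) then 1/3 else (1/3::real) ^ (m - 1))"
  define \<theta> where "\<theta> j = (if j \<in> C then s else 0)" for j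
  have sumth: "sum \<theta> R = real m * s"
    using CR R C by (simp add: \<theta>_def sum.If_cases Int_absorb1 Collect_mem_eq)
  show ?thesis
  proof (intro exI[of _ \<theta>] conjI allI impI)
    show "0 \<le> \<theta> j" for j by (auto simp: \<theta>_def s_def)
    show "sum \<theta> R \<le> 1" unfolding sumth s_def using of_nat_le_power3[of m] by (cases "m = 0") auto
    show "sum \<theta> R \<le> 2/3" if "\<forall>j. {j} \<notin> \<B>"
      unfolding sumth s_def using that of_nat_le_power3'[of m] by (cases "m = 0"; cases "m = 1") auto
    fix q assume "\<forall>j\<in>R. 0 \<le> q j \<and> 3 * real (card R) * q j \<le> 1"
    then have q: "\<And>j. j \<in> R \<Longrightarrow> 0 \<le> q j \<and> 3 * real (card R) * q j \<le> 1" by blast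
    have nn: "0 \<le> bits_weight R q b" for b
    proof (rule bits_weight_nonneg)
      fix j assume j: "j \<in> R"
      have "card R \<ge> 1" using j R by (metis One_nat_def Suc_leI card_gt_0_iff empty_iff)
      then have "q j * 1 \<le> q j * (3 * real (card R))" using q[OF j] by (intro mult_left_mono) auto
      then show "0 \<le> q j \<and> q j \<le> 1" using q[OF j] by (simp add: mult.commute)
    qed
    have each: "(\<Sum>b | b \<in> \<B> \<and> {j} \<subseteq> b. bits_weight R q b) \<le> s * q j" if j: "j \<in> C" for j
    proof (cases "m = 1 \<and> (\<forall>j. {j} \<notin> \<B>)")
      case False
      have "m \<ge> 1" using j C CR by (metis One_nat_def Suc_leI card_gt_0_iff empty_iff)
      \<comment> \<open>Branching starts from the single cover element \<open>j\<close>, which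
        leaves \<open>m - 1\<close> rounds, each contributing a factor 1/3.\<close>
      then have "(\<Sum>b | b \<in> \<B> \<and> {j} \<subseteq> b. bits_weight R q b) \<le> prod q {j} * (1/3) ^ (m - 1)"
        using q disj j CR by (intro bits_branching[OF R \<B>, where m = m]) auto
      then show ?thesis using False by (auto simp: s_def mult.commute)
    next
      case True
      \<comment> \<open>Without singletons every member through \<open>j\<close> has a second
        element \<open>i\<close>, and the probabilities \<open>q i\<close> sum to at most 1/3. This
        recovers the factor that branching cannot give for \<open>m = 1\<close>.\<close>
      have "{b. b \<in> \<B> \<and> {j} \<subseteq> b} \<subseteq> (\<Union>i\<in>R - {j}. {b. b \<subseteq> R \<and> {i, j} \<subseteq> b})"
      proof
        fix b assume b: "b \<in> {b. b \<in> \<B> \<and> {j} \<subseteq> b}"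
        then have "b \<noteq> {j}" using True by auto
        then obtain i where "i \<in> b" "i \<noteq> j" using b by auto
        then show "b \<in> (\<Union>i\<in>R - {j}. {b. b \<subseteq> R \<and> {i, j} \<subseteq> b})" using b \<B> by auto
      qed
      then have "(\<Sum>b | b \<in> \<B> \<and> {j} \<subseteq> b. bits_weight R q b)
          \<le> sum (bits_weight R q) (\<Union>i\<in>R - {j}. {b. b \<subseteq> R \<and> {i, j} \<subseteq> b})"
        using R nn by (intro sum_mono2) auto
      also have "\<dots> \<le> (\<Sum>i\<in>R - {j}. \<Sum>b | b \<subseteq> R \<and> {i, j} \<subseteq> b. bits_weight R q b)"
        using R nn by (intro sum_UN_le) auto
      also have "\<dots> = (\<Sum>i\<in>R - {j}. q i * q j)"
      proof (rule sum.cong[OF refl])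
        fix i assume "i \<in> R - {j}"
        then show "(\<Sum>b | b \<subseteq> R \<and> {i, j} \<subseteq> b. bits_weight R q b) = q i * q j"
          using sum_bits_weight_superset[OF R, of "{i, j}" q] j CR by auto
      qed
      also have "\<dots> \<le> (\<Sum>i\<in>R. q i * q j)" using R q j CR by (intro sum_mono2) auto
      also have "\<dots> = (\<Sum>i\<in>R. q i) * q j" by (simp add: sum_distrib_right)
      also have "\<dots> \<le> (1/3) * q j"
      proof (rule mult_right_mono)
        have "3 * real (card R) * (\<Sum>j\<in>R. q j) \<le> (\<Sum>j\<in>R. 1)"
          unfolding sum_distrib_left using q by (intro sum_mono) auto
        then show "(\<Sum>j\<in>R. q j) \<le> 1/3" using R
          by (cases "R = {}") (auto simp: field_simps card_gt_0_iff)
        show "0 \<le> q j" using q j CR by auto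
      qed
      finally show ?thesis using True by (simp add: s_def)
    qed
    have "\<B> \<subseteq> (\<Union>j\<in>C. {b. b \<in> \<B> \<and> {j} \<subseteq> b})" using C by (auto simp: cover_def)
    then have "(\<Sum>b\<in>\<B>. bits_weight R q b) \<le> sum (bits_weight R q) (\<Union>j\<in>C. {b. b \<in> \<B> \<and> {j} \<subseteq> b})"
      using fB CR nn by (intro sum_mono2) auto
    also have "\<dots> \<le> (\<Sum>j\<in>C. \<Sum>b | b \<in> \<B> \<and> {j} \<subseteq> b. bits_weight R q b)"
      using fB CR nn by (intro sum_UN_le) auto
    also have "\<dots> \<le> (\<Sum>j\<in>C. s * q j)" using each by (intro sum_mono) auto
    also have "\<dots> = (\<Sum>j\<in>R. \<theta> j * q j)"
      using R CR by (intro sum.mono_neutral_cong_left) (auto simp: \<theta>_def)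
    finally show "(\<Sum>b\<in>\<B>. bits_weight R q b) \<le> (\<Sum>j\<in>R. \<theta> j * q j)" .
  qed
qed

section \<open>Arcs of a cyclic order\<close>

definition arc :: "nat \<Rightarrow> nat \<Rightarrow> nat \<Rightarrow> nat set" where
  "arc n t k = (\<lambda>j. (t + j) mod n) ` {..<k}"

lemma arc_0 [simp]: "arc n t 0 = {}"
  by (simp add: arc_def)

lemma arc_subset: "0 < n \<Longrightarrow> arc n t k \<subseteq> {..<n}"
  by (auto simp: arc_def)

lemma add_mod_cancel:
  fixes t :: nat
  assumes "(t + i) mod n = (t + j) mod n" "i < n" "j < n"
  shows "i = j"
proof -
  have *: "i = j" if "(t + i) mod n = (t + j) mod n" "i \<le> j" "j < n" for i j
  proof -
    have "n dvd (t + j) - (t + i)" using that mod_eq_dvd_iff_nat[of "t + i" "t + j" n] by simp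
    then have "n dvd j - i" by simp
    then show ?thesis using that by (auto dest!: dvd_imp_le)
  qed
  show ?thesis using *[of i j] *[of j i] assms by (cases "i \<le> j") auto
qed

lemma card_arc: "k \<le> n \<Longrightarrow> card (arc n t k) = k"
  unfolding arc_def by (subst card_image) (auto intro!: inj_onI dest: add_mod_cancel)

lemma succ_mod_closed_eq:
  assumes "S \<subseteq> {..<n}" "S \<noteq> {}" "\<And>s. s \<in> S \<Longrightarrow> Suc s mod n \<in> S"
  shows "S = {..<n::nat}"
proof
  obtain s where s: "s \<in> S" using assms by auto
  have "(s + m) mod n \<in> S" for m
  proof (induction m)
    case 0 then show ?case using s assms by auto
  next
    case (Suc m)
    then show ?case using assms(3)[OF Suc] by (simp add: mod_Suc_eq)
  qed
  moreover have "u = (s + (n - s + u)) mod n" if "u < n" for u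
    using that s assms(1) by (auto simp: subset_iff)
  ultimately show "{..<n} \<subseteq> S" by (metis lessThan_iff subsetI)
qed fact

text \<open>A sumset bound in the integers modulo \<open>n\<close>, for a set and an interval.
  Lengthening the interval by one adds a point unless the sumset is closed under successor, and then
  it is the whole cycle.\<close>

lemma card_add_interval_mod:
  assumes "T \<subseteq> {..<n}" "T \<noteq> {}"
  shows "min n (card T + L) \<le> card ((\<lambda>(t, j). (t + c + j) mod n) ` (T \<times> {..<Suc L}))"
proof -
  define U where "U L = (\<lambda>(t, j). (t + c + j) mod n) ` (T \<times> {..<Suc L})" for L
  have n: "0 < n" using assms by auto
  have fT: "finite T" using assms finite_subset by blast
  have U: "U L \<subseteq> {..<n}" "U L \<noteq> {}" "finite (U L)" for L
    using n assms fT by (auto simp: U_def)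
  have "min n (card T + L) \<le> card (U L)"
  proof (induction L)
    case 0
    have "U 0 = (\<lambda>t. (c + t) mod n) ` T" by (force simp: U_def add.commute)
    moreover have "inj_on (\<lambda>t. (c + t) mod n) T"
      using assms by (auto intro!: inj_onI dest: add_mod_cancel)
    ultimately show ?case by (simp add: card_image)
  next
    case (Suc L)
    have sub: "U L \<subseteq> U (Suc L)" by (force simp: U_def)
    show ?case
    proof (cases "U L = {..<n}")
      case True
      then show ?thesis using card_mono[OF U(3) sub] by simp
    next
      case False
      then obtain s where s: "s \<in> U L" "Suc s mod n \<notin> U L"
        using succ_mod_closed_eq[OF U(1,2)] by blast
      obtain t j where tj: "t \<in> T" "j < Suc L" "s = (t + c + j) mod n" using s by (auto simp: U_def)
      then have "Suc s mod n = (t + c + Suc j) mod n" by (simp add: mod_Suc_eq)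
      then have "Suc s mod n \<in> U (Suc L)" using tj unfolding U_def by force
      then have "U L \<subset> U (Suc L)" using s sub by blast
      then have "card (U L) < card (U (Suc L))" using U by (intro psubset_card_mono)
      then show ?thesis using Suc by auto
    qed
  qed
  then show ?thesis by (simp add: U_def)
qed

text \<open>An arc of length \<open>k\<close> from \<open>t\<close> misses the arc of length
  \<open>k'\<close> from each of the \<open>n - k - k' + 1\<close> starting points from
  \<open>t + k\<close> on. So \<open>T'\<close> avoids a sumset of \<open>T\<close> with an
  interval, and that sumset is large.\<close>

lemma cross_intersecting_arcs:
  assumes T: "T \<subseteq> {..<n}" "T \<noteq> {}" "T' \<subseteq> {..<n}" "T' \<noteq> {}" and k: "k + k' \<le> n"
    and meet: "\<And>t t'. t \<in> T \<Longrightarrow> t' \<in> T' \<Longrightarrow> arc n t k \<inter> arc n t' k' \<noteq> {}"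
  shows "card T + card T' \<le> k + k'"
proof -
  define U where "U = (\<lambda>(t, j). (t + k + j) mod n) ` (T \<times> {..<Suc (n - k - k')})"
  have n: "0 < n" using T by auto
  have U: "min n (card T + (n - k - k')) \<le> card U"
    unfolding U_def by (rule card_add_interval_mod) (use T in auto)
  have "U \<inter> T' = {}"
  proof (rule ccontr)
    assume "U \<inter> T' \<noteq> {}"
    then obtain t j where tj: "t \<in> T" "j \<le> n - k - k'" "(t + k + j) mod n \<in> T'"
      by (auto simp: U_def less_Suc_eq_le simp del: lessThan_Suc)
    from meet[OF tj(1,3)] obtain i i' where i: "i < k" "i' < k'"
      "(t + i) mod n = ((t + k + j) mod n + i') mod n"
      by (auto simp: arc_def)
    then have "(t + i) mod n = (t + (k + j + i')) mod n" by (simp add: mod_add_left_eq add.assoc)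
    then have "i = k + j + i'" using i tj k by (intro add_mod_cancel[of t i n]) auto
    then show False using i by auto
  qed
  moreover have fin: "finite U" "finite T'"
    using finite_subset[OF T(1)] finite_subset[OF T(3)] by (auto simp: U_def)
  moreover have "card (U \<union> T') \<le> card {..<n}" using T n by (intro card_mono) (auto simp: U_def)
  ultimately have "card U + card T' \<le> n" by (simp add: card_Un_disjoint)
  \<comment> \<open>Since \<open>T'\<close> is nonempty, \<open>U\<close> is not the whole cycle, so
    the minimum in the bound for \<open>U\<close> is not \<open>n\<close>.\<close>
  moreover have "card T' \<ge> 1" using T fin by (simp add: Suc_le_eq card_gt_0_iff)
  ultimately show ?thesis using U k by linarith
qed

text \<open>In the application \<open>f\<close> of the \<open>n\<close> arcs of length \<open>k\<close> lie in a fibre. For a uniform threshold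
  \<open>r < K\<close> and a bit that is \<open>1\<close> with probability \<open>k / n\<close>, the fraction \<open>f / n\<close> is at most the probability
  that \<open>f \<ge> max 1 (k - r)\<close> (bit \<open>1\<close>) or \<open>f \<ge> k + r + 1\<close> (bit \<open>0\<close>).\<close>

lemma arc_threshold_count:
  fixes f k n K :: nat
  assumes "f \<le> n" "k \<le> K" "K + k \<le> n"
  shows "K * f \<le> k * card {r. r < K \<and> 1 \<le> k \<and> 1 \<le> f \<and> k \<le> f + r} + (n - k) * card {r. r < K \<and> k + r < f}"
proof -
  consider "f = 0" | "1 \<le> f" "f \<le> k" | "k < f" "f - k \<le> K" | "K < f - k" by linarith
  then show ?thesis
  proof cases
    case 2
    have "{r. r < K \<and> 1 \<le> k \<and> 1 \<le> f \<and> k \<le> f + r} = {k - f..<K}" using 2 by auto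
    \<comment> \<open>The right side exceeds the left one by
      \<open>(k - f) * (K - k)\<close>.\<close>
    moreover have "K * f \<le> k * (K - (k - f))"
    proof -
      obtain u where u: "K = k + u" using assms(2) le_Suc_ex by blast
      obtain v where v: "k = f + v" using 2 le_Suc_ex by blast
      show ?thesis by (simp add: u v algebra_simps)
    qed
    ultimately show ?thesis by simp
  next
    case 3
    have c1: "k * card {r. r < K \<and> 1 \<le> k \<and> 1 \<le> f \<and> k \<le> f + r} = k * K"
    proof (cases "k = 0")
      case False
      then have "{r. r < K \<and> 1 \<le> k \<and> 1 \<le> f \<and> k \<le> f + r} = {..<K}" using 3 by auto
      then show ?thesis by simp
    qed simp
    have "{r. r < K \<and> k + r < f} = {..<f - k}" using 3 by auto
    then have c2: "card {r. r < K \<and> k + r < f} = f - k" by simp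
    obtain u where u: "f = k + u" using 3 less_imp_le le_Suc_ex by blast
    have "K * u \<le> (n - k) * u" using assms by (intro mult_right_mono) auto
    then show ?thesis unfolding c1 c2 by (simp add: u algebra_simps)
  next
    case 4
    have c1: "k * card {r. r < K \<and> 1 \<le> k \<and> 1 \<le> f \<and> k \<le> f + r} = k * K"
    proof (cases "k = 0")
      case False
      then have "{r. r < K \<and> 1 \<le> k \<and> 1 \<le> f \<and> k \<le> f + r} = {..<K}" using 4 by auto
      then show ?thesis by simp
    qed simp
    have "{r. r < K \<and> k + r < f} = {..<K}" using 4 by auto
    then have c2: "card {r. r < K \<and> k + r < f} = K" by simp
    have "K * f \<le> K * n" using assms by simp
    also have "\<dots> = k * K + (n - k) * K" using assms by (simp add: algebra_simps flip: add_mult_distrib)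
    finally show ?thesis unfolding c1 c2 .
  qed simp
qed

lemma permutes_image_exists:
  assumes "finite U" "S \<subseteq> U" "S' \<subseteq> U" "card S = card S'"
  obtains g where "g permutes U" "g ` S = S'"
proof -
  have fin: "finite S" "finite S'" using assms finite_subset by auto
  obtain h where h: "bij_betw h S S'" using fin assms finite_same_card_bij by blast
  have "card (U - S) = card (U - S')" using assms fin by (simp add: card_Diff_subset)
  then obtain h' where h': "bij_betw h' (U - S) (U - S')"
    using assms finite_same_card_bij by (metis finite_Diff)
  define g where "g x = (if x \<in> S then h x else if x \<in> U then h' x else x)" for x
  have "bij_betw g S S'" using h by (rule bij_betw_cong[THEN iffD1, rotated]) (simp add: g_def)
  moreover have "bij_betw g (U - S) (U - S')"
    using h' by (rule bij_betw_cong[THEN iffD1, rotated]) (simp add: g_def)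
  ultimately have "bij_betw g (S \<union> (U - S)) (S' \<union> (U - S'))"
    by (rule bij_betw_combine) auto
  then have "bij_betw g U U" using assms by (simp add: Un_absorb1)
  then have "g permutes U" by (rule bij_imp_permutes) (use assms in \<open>auto simp: g_def\<close>)
  moreover have "g ` S = S'" using \<open>bij_betw g S S'\<close> by (simp add: bij_betw_def)
  ultimately show ?thesis by (rule that)
qed

text \<open>A uniformly random permutation carries \<open>S0\<close> to a uniformly random
  \<open>k\<close>-subset: composing with a permutation that maps \<open>S\<close> to
  \<open>S'\<close> injects the fibre \<open>P S\<close> into \<open>P S'\<close>, so all fibres
  have the same size.\<close>

lemma card_permutes_image_mem:
  assumes U: "finite U" "S0 \<subseteq> U" "card S0 = k" and \<T>: "\<T> \<subseteq> {S. S \<subseteq> U \<and> card S = k}"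
  shows "card {\<rho>. \<rho> permutes U \<and> \<rho> ` S0 \<in> \<T>} * (card U choose k) = fact (card U) * card \<T>"
proof -
  define P where "P S = {\<rho>. \<rho> permutes U \<and> \<rho> ` S0 = S}" for S
  have finP: "finite (P S)" for S
    unfolding P_def using finite_permutations[OF U(1)] by (rule rev_finite_subset) auto
  have le: "card (P S) \<le> card (P S')" if SS': "S \<subseteq> U" "S' \<subseteq> U" "card S = card S'" for S S'
  proof -
    obtain g where g: "g permutes U" "g ` S = S'" using permutes_image_exists[OF U(1) SS'] .
    show ?thesis
    proof (rule card_inj_on_le[OF _ _ finP])
      show "inj_on ((\<circ>) g) (P S)"
        using permutes_inj[OF g(1)] by (auto intro!: inj_onI simp: fun_eq_iff inj_eq)
      show "(\<circ>) g ` P S \<subseteq> P S'" using g by (auto simp: P_def permutes_compose image_comp[symmetric])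
    qed
  qed
  have eq: "card (P S) = card (P S0)" if "S \<subseteq> U" "card S = k" for S
    using le[of S S0] le[of S0 S] that U by auto
  have count: "card {\<rho>. \<rho> permutes U \<and> \<rho> ` S0 \<in> \<S>} = card \<S> * card (P S0)"
    if \<S>: "\<S> \<subseteq> {S. S \<subseteq> U \<and> card S = k}" for \<S>
  proof -
    have fS: "finite \<S>" using \<S> U by (intro finite_subset[OF _ finite_Pow_iff[THEN iffD2, OF U(1)]]) auto
    have "{\<rho>. \<rho> permutes U \<and> \<rho> ` S0 \<in> \<S>} = (\<Union>S\<in>\<S>. P S)" by (auto simp: P_def)
    also have "card \<dots> = (\<Sum>S\<in>\<S>. card (P S))"
      using fS finP by (intro card_UN_disjoint) (auto simp: P_def)
    also have "\<dots> = (\<Sum>S\<in>\<S>. card (P S0))" using \<S> eq by (intro sum.cong) auto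
    finally show ?thesis by simp
  qed
  have "{\<rho>. \<rho> permutes U \<and> \<rho> ` S0 \<in> {S. S \<subseteq> U \<and> card S = k}} = {\<rho>. \<rho> permutes U}"
  proof -
    have "\<rho> ` S0 \<subseteq> U \<and> card (\<rho> ` S0) = k" if \<rho>: "\<rho> permutes U" for \<rho>
      using U permutes_image[OF \<rho>] permutes_inj[OF \<rho>]
      by (metis card_image image_mono inj_on_subset subset_UNIV)
    then show ?thesis by auto
  qed
  then have "fact (card U) = (card U choose k) * card (P S0)"
    using count[OF subset_refl] card_permutations[OF refl U(1)] n_subsets[OF U(1), of k] by simp
  then show ?thesis using count[OF \<T>] by (simp add: mult_ac)
qed

section \<open>Replacing blocks by bits\<close>

text \<open>The element \<open>x i\<close> encodes the bit of block \<open>i\<close>. All cyclic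
  orders used are \<open>\<rho> \<circ> \<sigma> i\<close> for a permutation \<open>\<rho>\<close>;
  naming the base order \<open>\<sigma> i\<close> makes \<open>\<rho> = id\<close> a branch whose
  layout can be prescribed.\<close>

locale blocks =
  fixes I :: "'i set" and B :: "'i \<Rightarrow> 'a set" and x :: "'i \<Rightarrow> 'a"
    and T :: "'t set" and \<kappa> :: "'t \<Rightarrow> 'i \<Rightarrow> nat" and b :: "'i \<Rightarrow> nat" and \<sigma> :: "'i \<Rightarrow> nat \<Rightarrow> 'a"
  assumes finite_I: "finite I"
    and finite_B: "i \<in> I \<Longrightarrow> finite (B i)"
    and disjoint_B: "disjoint_family_on B I"
    and x_in: "i \<in> I \<Longrightarrow> x i \<in> B i"
    and finite_T: "finite T"
    and \<kappa>_le: "\<tau> \<in> T \<Longrightarrow> i \<in> I \<Longrightarrow> \<kappa> \<tau> i \<le> b i"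
    and b_le: "i \<in> I \<Longrightarrow> 3 * card I * b i \<le> card (B i)"
    and bij_\<sigma>: "i \<in> I \<Longrightarrow> bij_betw (\<sigma> i) {..<card (B i)} (B i)"
begin

definition X :: "'a set" where "X = (\<Union>i\<in>I. B i)"

abbreviation n :: "'i \<Rightarrow> nat" where "n i \<equiv> card (B i)"

text \<open>The number of thresholds. The counting of arcs asks for
  \<open>K + \<kappa> \<le> n\<close>, and \<open>n - b\<close> is the largest number satisfying
  this for every \<open>\<kappa> \<le> b\<close>; a large \<open>K\<close> makes the top threshold
  as demanding as possible.\<close>

abbreviation K :: "'i \<Rightarrow> nat" where "K i \<equiv> n i - b i"

abbreviation q :: "'t \<Rightarrow> 'i \<Rightarrow> real" where "q \<tau> i \<equiv> \<kappa> \<tau> i / n i"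

definition cross_meeting :: "('t \<Rightarrow> 'a set set) \<Rightarrow> bool" where
  "cross_meeting A \<longleftrightarrow> (\<forall>\<tau>\<in>T. \<forall>\<tau>'\<in>T. \<forall>F\<in>A \<tau>. \<forall>F'\<in>A \<tau>'. F \<inter> F' \<noteq> {})"

text \<open>\<open>D\<close> is the set of blocks that have already been replaced by bits.\<close>

definition valid :: "'i set \<Rightarrow> ('t \<Rightarrow> 'a set set) \<Rightarrow> bool" where
  "valid D A \<longleftrightarrow> (\<forall>\<tau>\<in>T. \<forall>F\<in>A \<tau>. F \<subseteq> X \<and> (\<forall>i\<in>D. F \<inter> B i \<subseteq> {x i}) \<and> (\<forall>i\<in>I - D. card (F \<inter> B i) = \<kappa> \<tau> i))"

definition hits :: "'i \<Rightarrow> (nat \<Rightarrow> 'a) \<Rightarrow> ('t \<Rightarrow> 'a set set) \<Rightarrow> 't \<Rightarrow> 'a set \<Rightarrow> nat set" where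
  "hits i s A \<tau> Y = {t. t < n i \<and> s ` arc (n i) t (\<kappa> \<tau> i) \<union> Y \<in> A \<tau>}"

text \<open>Block \<open>i\<close> is replaced by a single bit, encoded as the presence of \<open>x i\<close>. Two fibres over disjoint
  sets have at most \<open>\<kappa> \<tau> i + \<kappa> \<tau>' i\<close> arcs together, so two processed sets that meet nowhere else must
  both have the bit set.\<close>

definition process :: "'i \<Rightarrow> (nat \<Rightarrow> 'a) \<Rightarrow> nat \<Rightarrow> ('t \<Rightarrow> 'a set set) \<Rightarrow> 't \<Rightarrow> 'a set set" where
  "process i s r A \<tau> =
     {Y. Y \<subseteq> X - B i \<and> \<kappa> \<tau> i + r < card (hits i s A \<tau> Y)} \<union>
     insert (x i) ` {Y. Y \<subseteq> X - B i \<and> 1 \<le> \<kappa> \<tau> i \<and> 1 \<le> card (hits i s A \<tau> Y) \<and> \<kappa> \<tau> i \<le> card (hits i s A \<tau> Y) + r}"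

text \<open>A replaced block contributes the number of sets it stands for times the probability of
  its bit; an untouched block contributes 1. Thus \<open>W {}\<close> counts sets, and
  \<open>W I\<close> is a sum over types of a product of binomials times a measure of bit
  sets.\<close>

definition weight :: "'i set \<Rightarrow> 't \<Rightarrow> 'a set \<Rightarrow> real" where
  "weight D \<tau> F = (\<Prod>i\<in>D. real (n i choose \<kappa> \<tau> i) * (if x i \<in> F then q \<tau> i else 1 - q \<tau> i))"

definition W :: "'i set \<Rightarrow> ('t \<Rightarrow> 'a set set) \<Rightarrow> real" where
  "W D A = (\<Sum>\<tau>\<in>T. \<Sum>F\<in>A \<tau>. weight D \<tau> F)"

text \<open>For the family of all sets with type in \<open>T\<close> this is the size of a star centred in block \<open>i\<close>.\<close>

definition star_weight :: "'i \<Rightarrow> real" where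
  "star_weight i = (\<Sum>\<tau>\<in>T. (\<Prod>j\<in>I. real (n j choose \<kappa> \<tau> j)) * q \<tau> i)"

lemma finite_X: "finite X"
  using finite_I finite_B by (auto simp: X_def)

lemma n_pos: "i \<in> I \<Longrightarrow> 0 < n i"
  using finite_B x_in by (auto simp: card_gt_0_iff)

lemma b_le_n: "i \<in> I \<Longrightarrow> 3 * b i \<le> n i"
proof -
  assume i: "i \<in> I"
  then have "1 \<le> card I" using finite_I by (simp add: Suc_le_eq card_gt_0_iff) blast
  then have "1 * (3 * b i) \<le> card I * (3 * b i)" by (rule mult_le_mono1)
  moreover have "card I * (3 * b i) \<le> n i" using b_le[OF i] by (simp only: mult_ac)
  ultimately show ?thesis by linarith
qed

lemma K_bounds:
  assumes "i \<in> I"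
  shows "0 < K i" "\<tau> \<in> T \<Longrightarrow> \<kappa> \<tau> i \<le> K i" "\<tau> \<in> T \<Longrightarrow> K i + \<kappa> \<tau> i \<le> n i"
  using b_le_n[OF assms] n_pos[OF assms] \<kappa>_le[OF _ assms, of \<tau>] by linarith+

lemma q_bounds: "\<tau> \<in> T \<Longrightarrow> i \<in> I \<Longrightarrow> 0 \<le> q \<tau> i \<and> q \<tau> i \<le> 1"
  using K_bounds(3)[of i \<tau>] n_pos[of i] by auto

lemma weight_nonneg: "\<tau> \<in> T \<Longrightarrow> D \<subseteq> I \<Longrightarrow> 0 \<le> weight D \<tau> F"
  unfolding weight_def using q_bounds by (intro prod_nonneg) auto

lemma weight_cong: "(\<And>i. i \<in> D \<Longrightarrow> x i \<in> F \<longleftrightarrow> x i \<in> F') \<Longrightarrow> weight D \<tau> F = weight D \<tau> F'"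
  unfolding weight_def by (intro prod.cong) auto

lemma disjoint_blocks: "i \<in> I \<Longrightarrow> j \<in> I \<Longrightarrow> i \<noteq> j \<Longrightarrow> B i \<inter> B j = {}"
  using disjoint_B by (auto simp: disjoint_family_on_def)

lemma card_hits_le: "card (hits i s A \<tau> Y) \<le> n i"
proof -
  have "card (hits i s A \<tau> Y) \<le> card {..<n i}" unfolding hits_def by (intro card_mono) auto
  then show ?thesis by simp
qed

lemma process_cases:
  assumes i: "i \<in> I" and F: "F \<in> process i s r A \<tau>"
  defines "Y \<equiv> F - B i"
  shows "Y \<subseteq> X - B i" "1 \<le> card (hits i s A \<tau> Y)"
    "F = Y \<and> \<kappa> \<tau> i + r < card (hits i s A \<tau> Y) \<or>
     F = insert (x i) Y \<and> 1 \<le> \<kappa> \<tau> i \<and> \<kappa> \<tau> i \<le> card (hits i s A \<tau> Y) + r"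
proof -
  consider "F \<subseteq> X - B i" "\<kappa> \<tau> i + r < card (hits i s A \<tau> F)"
    | Z where "F = insert (x i) Z" "Z \<subseteq> X - B i" "1 \<le> \<kappa> \<tau> i" "1 \<le> card (hits i s A \<tau> Z)"
      "\<kappa> \<tau> i \<le> card (hits i s A \<tau> Z) + r"
    using F unfolding process_def by blast
  then have "Y \<subseteq> X - B i \<and> 1 \<le> card (hits i s A \<tau> Y) \<and> (F = Y \<and> \<kappa> \<tau> i + r < card (hits i s A \<tau> Y) \<or>
     F = insert (x i) Y \<and> 1 \<le> \<kappa> \<tau> i \<and> \<kappa> \<tau> i \<le> card (hits i s A \<tau> Y) + r)"
  proof cases
    case 1
    then have "Y = F" by (auto simp: Y_def)
    then show ?thesis using 1 by simp
  next
    case (2 Z)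
    then have "Y = Z" using x_in[OF i] by (auto simp: Y_def)
    then show ?thesis using 2 by simp
  qed
  then show "Y \<subseteq> X - B i" "1 \<le> card (hits i s A \<tau> Y)"
    "F = Y \<and> \<kappa> \<tau> i + r < card (hits i s A \<tau> Y) \<or>
     F = insert (x i) Y \<and> 1 \<le> \<kappa> \<tau> i \<and> \<kappa> \<tau> i \<le> card (hits i s A \<tau> Y) + r" by auto
qed

lemma cross_meeting_process:
  assumes i: "i \<in> I" and s: "bij_betw s {..<n i} (B i)" and A: "cross_meeting A"
  shows "cross_meeting (process i s r A)"
  unfolding cross_meeting_def
proof (intro ballI notI)
  fix \<tau> \<tau>' F F'
  assume \<tau>: "\<tau> \<in> T" "\<tau>' \<in> T" and F: "F \<in> process i s r A \<tau>" "F' \<in> process i s r A \<tau>'" and dis: "F \<inter> F' = {}"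
  define Y where "Y = F - B i"
  define Y' where "Y' = F' - B i"
  let ?h = "hits i s A \<tau> Y" and ?h' = "hits i s A \<tau>' Y'"
  note c = process_cases[OF i F(1), folded Y_def] and c' = process_cases[OF i F(2), folded Y'_def]
  have "card ?h + card ?h' \<le> \<kappa> \<tau> i + \<kappa> \<tau>' i"
  proof (rule cross_intersecting_arcs)
    show "?h \<subseteq> {..<n i}" "?h' \<subseteq> {..<n i}" by (auto simp: hits_def)
    show "?h \<noteq> {}" "?h' \<noteq> {}" using c(2) c'(2) by force+
    show "\<kappa> \<tau> i + \<kappa> \<tau>' i \<le> n i" using \<kappa>_le[OF \<tau>(1) i] \<kappa>_le[OF \<tau>(2) i] b_le_n[OF i] by linarith
    fix t t' assume t: "t \<in> ?h" "t' \<in> ?h'"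
    let ?a = "arc (n i) t (\<kappa> \<tau> i)" and ?a' = "arc (n i) t' (\<kappa> \<tau>' i)"
    have sub: "?a \<subseteq> {..<n i}" "?a' \<subseteq> {..<n i}" using arc_subset n_pos[OF i] by auto
    have "s ` ?a \<union> Y \<in> A \<tau>" "s ` ?a' \<union> Y' \<in> A \<tau>'" using t by (simp_all add: hits_def)
    then have "(s ` ?a \<union> Y) \<inter> (s ` ?a' \<union> Y') \<noteq> {}"
      using A \<tau> unfolding cross_meeting_def by blast
    then obtain z where z: "z \<in> s ` ?a \<union> Y" "z \<in> s ` ?a' \<union> Y'" by blast
    have im: "s ` ?a \<subseteq> B i" "s ` ?a' \<subseteq> B i" using s image_mono[OF sub(1), of s] image_mono[OF sub(2), of s]
      by (simp_all add: bij_betw_def)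
    have "z \<notin> Y \<or> z \<notin> Y'" using dis by (auto simp: Y_def Y'_def)
    moreover have "z \<in> Y \<Longrightarrow> z \<notin> B i" "z \<in> Y' \<Longrightarrow> z \<notin> B i" by (auto simp: Y_def Y'_def)
    ultimately have "z \<in> s ` ?a" "z \<in> s ` ?a'" using z im by (metis Un_iff subsetD)+
    then have "s ` ?a \<inter> s ` ?a' \<noteq> {}" by (metis IntI empty_iff)
    moreover have "s ` (?a \<inter> ?a') = s ` ?a \<inter> s ` ?a'"
      using s sub by (intro inj_on_image_Int) (auto simp: bij_betw_def)
    ultimately show "?a \<inter> ?a' \<noteq> {}" by (metis image_empty)
  qed
  moreover have "\<not> (F = insert (x i) Y \<and> F' = insert (x i) Y')" using dis by auto
  \<comment> \<open>A bit 0 requires more than \<open>\<kappa> + r\<close> arcs, a bit 1 at least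
    \<open>\<kappa> - r\<close>. With the same \<open>r\<close> on both sides, the two counts add up
    to more than \<open>\<kappa> \<tau> i + \<kappa> \<tau>' i\<close> unless both bits are
    1.\<close>
  ultimately show False using c(3) c'(3) by linarith
qed

text \<open>Every processed set has at least one hit, hence comes from some \<open>G\<close> in
  \<open>A \<tau>\<close> with the same traces on all other blocks.\<close>

lemma valid_process:
  assumes i: "i \<in> I" "i \<notin> D" "D \<subseteq> I" and s: "bij_betw s {..<n i} (B i)" and A: "valid D A"
  shows "valid (insert i D) (process i s r A)"
  unfolding valid_def
proof (intro ballI)
  fix \<tau> F assume \<tau>: "\<tau> \<in> T" and F: "F \<in> process i s r A \<tau>"
  obtain Y where Y: "F = Y \<or> F = insert (x i) Y" "Y \<subseteq> X - B i" "1 \<le> card (hits i s A \<tau> Y)"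
    using process_cases[OF i(1) F] by blast
  then have "hits i s A \<tau> Y \<noteq> {}" by force
  then obtain t where t: "t \<in> hits i s A \<tau> Y" by blast
  define G where "G = s ` arc (n i) t (\<kappa> \<tau> i) \<union> Y"
  have G: "G \<in> A \<tau>" using t by (simp add: hits_def G_def)
  have "s ` arc (n i) t (\<kappa> \<tau> i) \<subseteq> B i"
    using s image_mono[OF arc_subset[OF n_pos[OF i(1)]], of s] by (simp add: bij_betw_def)
  then have other: "F \<inter> B j = G \<inter> B j" if "j \<in> I" "j \<noteq> i" for j
    using Y(1) disjoint_blocks[OF that(1) i(1) that(2)] x_in[OF i(1)] unfolding G_def by blast
  have "F \<inter> B i \<subseteq> {x i}" using Y by auto
  moreover have "F \<subseteq> X" using Y x_in[OF i(1)] i by (auto simp: X_def)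
  ultimately show "F \<subseteq> X \<and> (\<forall>j\<in>insert i D. F \<inter> B j \<subseteq> {x j}) \<and> (\<forall>j\<in>I - insert i D. card (F \<inter> B j) = \<kappa> \<tau> j)"
  proof (intro conjI ballI)
    fix j assume "j \<in> insert i D"
    then show "F \<inter> B j \<subseteq> {x j}"
      using \<open>F \<inter> B i \<subseteq> {x i}\<close> other[of j] A G \<tau> i unfolding valid_def by (metis insert_iff subsetD)
  next
    fix j assume "j \<in> I - insert i D"
    then show "card (F \<inter> B j) = \<kappa> \<tau> j" using other[of j] A G \<tau> unfolding valid_def by auto
  qed
qed

section \<open>The averaging inequality for one block\<close>

lemma sum_weight_fibres:
  assumes i: "i \<in> I" "i \<notin> D" "D \<subseteq> I" and A: "valid D A" and \<tau>: "\<tau> \<in> T"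
  shows "(\<Sum>F\<in>A \<tau>. weight D \<tau> F) =
    (\<Sum>Y\<in>Pow (X - B i). weight D \<tau> Y * card {S. S \<subseteq> B i \<and> S \<union> Y \<in> A \<tau>})"
proof -
  have sub: "A \<tau> \<subseteq> Pow X" using A \<tau> unfolding valid_def by blast
  have fin: "finite (A \<tau>)" using sub finite_X finite_subset by blast
  have "(\<Sum>F\<in>A \<tau>. weight D \<tau> F) = (\<Sum>Y\<in>Pow (X - B i). \<Sum>F | F \<in> A \<tau> \<and> F - B i = Y. weight D \<tau> F)"
    using fin finite_X sub by (intro sum.group[symmetric]) auto
  also have "\<dots> = (\<Sum>Y\<in>Pow (X - B i). weight D \<tau> Y * card {S. S \<subseteq> B i \<and> S \<union> Y \<in> A \<tau>})"
  proof (rule sum.cong[OF refl])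
    fix Y assume Y: "Y \<in> Pow (X - B i)"
    have w: "weight D \<tau> F = weight D \<tau> Y" if "F - B i = Y" for F
    proof (rule weight_cong)
      fix j assume j: "j \<in> D"
      then have "x j \<notin> B i" using disjoint_blocks[of j i] x_in[of j] i by auto
      then show "x j \<in> F \<longleftrightarrow> x j \<in> Y" using that by auto
    qed
    have bij: "bij_betw (\<lambda>S. S \<union> Y) {S. S \<subseteq> B i \<and> S \<union> Y \<in> A \<tau>} {F. F \<in> A \<tau> \<and> F - B i = Y}"
    proof (rule bij_betwI[where g = "\<lambda>F. F \<inter> B i"])
      show "(\<lambda>S. S \<union> Y) \<in> {S. S \<subseteq> B i \<and> S \<union> Y \<in> A \<tau>} \<rightarrow> {F. F \<in> A \<tau> \<and> F - B i = Y}"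
        using Y by auto
      have "F \<inter> B i \<union> (F - B i) = F" for F by auto
      then show "(\<lambda>F. F \<inter> B i) \<in> {F. F \<in> A \<tau> \<and> F - B i = Y} \<rightarrow> {S. S \<subseteq> B i \<and> S \<union> Y \<in> A \<tau>}"
        by auto
    qed (use Y in auto)
    have "(\<Sum>F | F \<in> A \<tau> \<and> F - B i = Y. weight D \<tau> F) = (\<Sum>F | F \<in> A \<tau> \<and> F - B i = Y. weight D \<tau> Y)"
      using w by (intro sum.cong) auto
    then show "(\<Sum>F | F \<in> A \<tau> \<and> F - B i = Y. weight D \<tau> F)
        = weight D \<tau> Y * card {S. S \<subseteq> B i \<and> S \<union> Y \<in> A \<tau>}"
      using bij_betw_same_card[OF bij] by simp
  qed
  finally show ?thesis .
qed

lemma sum_weight_process: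
  assumes i: "i \<in> I" "i \<notin> D" "D \<subseteq> I"
  shows "(\<Sum>F\<in>process i s r A \<tau>. weight (insert i D) \<tau> F) =
    (\<Sum>Y\<in>Pow (X - B i). weight D \<tau> Y * (real (n i choose \<kappa> \<tau> i) *
      ((1 - q \<tau> i) * of_bool (\<kappa> \<tau> i + r < card (hits i s A \<tau> Y)) +
       q \<tau> i * of_bool (1 \<le> \<kappa> \<tau> i \<and> 1 \<le> card (hits i s A \<tau> Y) \<and> \<kappa> \<tau> i \<le> card (hits i s A \<tau> Y) + r))))"
proof -
  define P0 where "P0 Y \<longleftrightarrow> \<kappa> \<tau> i + r < card (hits i s A \<tau> Y)" for Y
  define P1 where "P1 Y \<longleftrightarrow> 1 \<le> \<kappa> \<tau> i \<and> 1 \<le> card (hits i s A \<tau> Y) \<and> \<kappa> \<tau> i \<le> card (hits i s A \<tau> Y) + r" for Y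
  have xi: "x i \<in> B i" using i x_in by auto
  have finD: "finite D" using i finite_I finite_subset by blast
  have fin: "finite (Pow (X - B i))" using finite_X by simp
  have p: "process i s r A \<tau> = {Y \<in> Pow (X - B i). P0 Y} \<union> insert (x i) ` {Y \<in> Pow (X - B i). P1 Y}"
    unfolding process_def P0_def P1_def Pow_iff by simp
  have xj: "x j \<noteq> x i" if "j \<in> D" for j
    using disjoint_blocks[of j i] x_in[of j] xi i that by (metis IntI empty_iff subsetD)
  have w0: "weight (insert i D) \<tau> Y = weight D \<tau> Y * (real (n i choose \<kappa> \<tau> i) * (1 - q \<tau> i))"
    if "Y \<in> Pow (X - B i)" for Y
    using that xi finD i unfolding weight_def by auto
  have w1: "weight (insert i D) \<tau> (insert (x i) Y) = weight D \<tau> Y * (real (n i choose \<kappa> \<tau> i) * q \<tau> i)" for Y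
  proof -
    have "weight D \<tau> (insert (x i) Y) = weight D \<tau> Y" using xj by (intro weight_cong) auto
    then show ?thesis using finD i unfolding weight_def by simp
  qed
  have "(\<Sum>F\<in>process i s r A \<tau>. weight (insert i D) \<tau> F) =
      (\<Sum>F | F \<in> Pow (X - B i) \<and> P0 F. weight (insert i D) \<tau> F) +
      (\<Sum>F\<in>insert (x i) ` {Y \<in> Pow (X - B i). P1 Y}. weight (insert i D) \<tau> F)"
    unfolding p using fin xi by (intro sum.union_disjoint) auto
  also have "(\<Sum>F\<in>insert (x i) ` {Y \<in> Pow (X - B i). P1 Y}. weight (insert i D) \<tau> F)
      = (\<Sum>Y | Y \<in> Pow (X - B i) \<and> P1 Y. weight (insert i D) \<tau> (insert (x i) Y))"
  proof (rule sum.reindex_cong[OF _ refl refl], rule inj_onI)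
    fix Y Z assume "Y \<in> {Y \<in> Pow (X - B i). P1 Y}" "Z \<in> {Y \<in> Pow (X - B i). P1 Y}" "insert (x i) Y = insert (x i) Z"
    moreover from this have "x i \<notin> Y" "x i \<notin> Z" using xi by auto
    ultimately show "Y = Z" by (simp add: insert_ident)
  qed
  also have "(\<Sum>F | F \<in> Pow (X - B i) \<and> P0 F. weight (insert i D) \<tau> F)
      = (\<Sum>Y\<in>Pow (X - B i). weight D \<tau> Y * (real (n i choose \<kappa> \<tau> i) * (1 - q \<tau> i)) * of_bool (P0 Y))"
    using fin w0 by (intro sum.mono_neutral_cong_left) auto
  also have "(\<Sum>Y | Y \<in> Pow (X - B i) \<and> P1 Y. weight (insert i D) \<tau> (insert (x i) Y))
      = (\<Sum>Y\<in>Pow (X - B i). weight D \<tau> Y * (real (n i choose \<kappa> \<tau> i) * q \<tau> i) * of_bool (P1 Y))"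
    using fin w1 by (intro sum.mono_neutral_cong_left) auto
  finally show ?thesis unfolding P0_def[symmetric] P1_def[symmetric] sum.distrib[symmetric]
    by (simp add: algebra_simps)
qed

text \<open>Double counting of pairs of a permutation and an arc position. For each fixed position
  the permuted arc is uniform among the subsets of size \<open>\<kappa> \<tau> i\<close>, so the
  average fraction of hits equals the density of the fibre over \<open>Y\<close>.\<close>

lemma sum_card_hits:
  assumes i: "i \<in> I" "i \<notin> D" and A: "valid D A" and \<tau>: "\<tau> \<in> T" and Y: "Y \<subseteq> X - B i"
  shows "(\<Sum>\<rho> | \<rho> permutes B i. card (hits i (\<rho> \<circ> \<sigma> i) A \<tau> Y)) * (n i choose \<kappa> \<tau> i) =
    n i * fact (n i) * card {S. S \<subseteq> B i \<and> S \<union> Y \<in> A \<tau>}"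
proof -
  define \<T> where "\<T> = {S. S \<subseteq> B i \<and> S \<union> Y \<in> A \<tau>}"
  have fB: "finite (B i)" using finite_B i by auto
  have fin: "finite {\<rho>. \<rho> permutes B i}" using finite_permutations[OF fB] .
  have \<T>: "\<T> \<subseteq> {S. S \<subseteq> B i \<and> card S = \<kappa> \<tau> i}"
  proof
    fix S assume S: "S \<in> \<T>"
    then have "card ((S \<union> Y) \<inter> B i) = \<kappa> \<tau> i" using A i \<tau> by (simp add: valid_def \<T>_def)
    moreover have "(S \<union> Y) \<inter> B i = S" using S Y by (auto simp: \<T>_def)
    ultimately show "S \<in> {S. S \<subseteq> B i \<and> card S = \<kappa> \<tau> i}" using S by (simp add: \<T>_def)
  qed
  have S0: "\<sigma> i ` arc (n i) t (\<kappa> \<tau> i) \<subseteq> B i" "card (\<sigma> i ` arc (n i) t (\<kappa> \<tau> i)) = \<kappa> \<tau> i" for t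
  proof -
    have sub: "arc (n i) t (\<kappa> \<tau> i) \<subseteq> {..<n i}" using arc_subset n_pos[OF i(1)] by blast
    show "\<sigma> i ` arc (n i) t (\<kappa> \<tau> i) \<subseteq> B i"
      using bij_\<sigma>[OF i(1)] image_mono[OF sub, of "\<sigma> i"] by (simp add: bij_betw_def)
    have "card (\<sigma> i ` arc (n i) t (\<kappa> \<tau> i)) = card (arc (n i) t (\<kappa> \<tau> i))"
      using bij_\<sigma>[OF i(1)] sub by (intro card_image) (auto simp: bij_betw_def intro: inj_on_subset)
    then show "card (\<sigma> i ` arc (n i) t (\<kappa> \<tau> i)) = \<kappa> \<tau> i"
      using card_arc K_bounds(3)[OF i(1) \<tau>] by simp
  qed
  have h: "hits i (\<rho> \<circ> \<sigma> i) A \<tau> Y = {t. t < n i \<and> \<rho> ` (\<sigma> i ` arc (n i) t (\<kappa> \<tau> i)) \<in> \<T>}"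
    if \<rho>: "\<rho> permutes B i" for \<rho>
  proof -
    have "\<rho> ` (\<sigma> i ` arc (n i) t (\<kappa> \<tau> i)) \<subseteq> B i" for t
      using image_mono[OF S0(1)[of t], of \<rho>] permutes_image[OF \<rho>] by simp
    then show ?thesis unfolding hits_def \<T>_def image_comp by simp
  qed
  have "(\<Sum>\<rho> | \<rho> permutes B i. card (hits i (\<rho> \<circ> \<sigma> i) A \<tau> Y))
      = (\<Sum>\<rho> | \<rho> permutes B i. \<Sum>t<n i. of_bool (\<rho> ` (\<sigma> i ` arc (n i) t (\<kappa> \<tau> i)) \<in> \<T>))"
  proof (rule sum.cong[OF refl])
    fix \<rho> assume "\<rho> \<in> {\<rho>. \<rho> permutes B i}"
    then have "hits i (\<rho> \<circ> \<sigma> i) A \<tau> Y = {..<n i} \<inter> {t. \<rho> ` (\<sigma> i ` arc (n i) t (\<kappa> \<tau> i)) \<in> \<T>}"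
      using h by auto
    then show "card (hits i (\<rho> \<circ> \<sigma> i) A \<tau> Y) = (\<Sum>t<n i. of_bool (\<rho> ` (\<sigma> i ` arc (n i) t (\<kappa> \<tau> i)) \<in> \<T>))"
      by (simp add: sum.If_cases of_bool_def)
  qed
  also have "\<dots> = (\<Sum>t<n i. card {\<rho>. \<rho> permutes B i \<and> \<rho> ` (\<sigma> i ` arc (n i) t (\<kappa> \<tau> i)) \<in> \<T>})"
    using fin by (subst sum.swap) (simp add: of_bool_def sum.If_cases Int_def)
  finally have "(\<Sum>\<rho> | \<rho> permutes B i. card (hits i (\<rho> \<circ> \<sigma> i) A \<tau> Y)) * (n i choose \<kappa> \<tau> i)
      = (\<Sum>t<n i. card {\<rho>. \<rho> permutes B i \<and> \<rho> ` (\<sigma> i ` arc (n i) t (\<kappa> \<tau> i)) \<in> \<T>} * (n i choose \<kappa> \<tau> i))"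
    by (simp add: sum_distrib_right)
  also have "\<dots> = (\<Sum>t<n i. fact (n i) * card \<T>)"
    by (intro sum.cong refl card_permutes_image_mem fB S0 \<T>)
  finally show ?thesis by (simp add: \<T>_def mult_ac)
qed

text \<open>The inequality holds fibre by fibre: \<open>sum_card_hits\<close> turns the size of a
  fibre into an average number of hits, and \<open>arc_threshold_count\<close> bounds the hits of
  each cyclic order by the bit mass averaged over the thresholds. Nonnegative weights allow
  summation over the fibres.\<close>

lemma W_step:
  assumes i: "i \<in> I" "i \<notin> D" "D \<subseteq> I" and A: "valid D A"
  shows "fact (n i) * real (K i) * W D A
    \<le> (\<Sum>\<rho> | \<rho> permutes B i. \<Sum>r<K i. W (insert i D) (process i (\<rho> \<circ> \<sigma> i) r A))"
proof -
  let ?P = "{\<rho>. \<rho> permutes B i}"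
  define h where "h \<tau> \<rho> Y = card (hits i (\<rho> \<circ> \<sigma> i) A \<tau> Y)" for \<tau> \<rho> Y
  define c where "c \<tau> \<rho> r Y = (1 - q \<tau> i) * of_bool (\<kappa> \<tau> i + r < h \<tau> \<rho> Y) +
       q \<tau> i * of_bool (1 \<le> \<kappa> \<tau> i \<and> 1 \<le> h \<tau> \<rho> Y \<and> \<kappa> \<tau> i \<le> h \<tau> \<rho> Y + r)" for \<tau> \<rho> r Y
  have npos: "0 < real (n i)" using n_pos[OF i(1)] by simp
  have one: "real (K i) * h \<tau> \<rho> Y \<le> real (n i) * (\<Sum>r<K i. c \<tau> \<rho> r Y)" if \<tau>: "\<tau> \<in> T" for \<tau> \<rho> Y
  proof -
    let ?C1 = "{r. r < K i \<and> 1 \<le> \<kappa> \<tau> i \<and> 1 \<le> h \<tau> \<rho> Y \<and> \<kappa> \<tau> i \<le> h \<tau> \<rho> Y + r}"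
    let ?C0 = "{r. r < K i \<and> \<kappa> \<tau> i + r < h \<tau> \<rho> Y}"
    have "K i * h \<tau> \<rho> Y \<le> \<kappa> \<tau> i * card ?C1 + (n i - \<kappa> \<tau> i) * card ?C0"
      using K_bounds[OF i(1)] \<tau> by (intro arc_threshold_count) (auto simp: h_def card_hits_le)
    then have "real (K i * h \<tau> \<rho> Y) \<le> real (\<kappa> \<tau> i * card ?C1 + (n i - \<kappa> \<tau> i) * card ?C0)"
      by (rule of_nat_mono)
    also have "\<dots> = real (n i) * (q \<tau> i * card ?C1 + (1 - q \<tau> i) * card ?C0)"
      using npos K_bounds(3)[OF i(1) \<tau>] by (simp add: field_simps of_nat_diff)
    also have "q \<tau> i * card ?C1 + (1 - q \<tau> i) * card ?C0 = (\<Sum>r<K i. c \<tau> \<rho> r Y)"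
      unfolding c_def sum.distrib sum_distrib_left[symmetric]
      by (simp add: of_bool_def sum.If_cases Int_def)
    finally show ?thesis by simp
  qed
  have fibre: "fact (n i) * real (K i) * card {S. S \<subseteq> B i \<and> S \<union> Y \<in> A \<tau>}
      \<le> (\<Sum>\<rho>\<in>?P. \<Sum>r<K i. real (n i choose \<kappa> \<tau> i) * c \<tau> \<rho> r Y)"
    if \<tau>: "\<tau> \<in> T" and Y: "Y \<in> Pow (X - B i)" for \<tau> Y
  proof -
    let ?card = "card {S. S \<subseteq> B i \<and> S \<union> Y \<in> A \<tau>}"
    have "real ((\<Sum>\<rho>\<in>?P. h \<tau> \<rho> Y) * (n i choose \<kappa> \<tau> i)) = real (n i * fact (n i) * ?card)"
      unfolding h_def using sum_card_hits[OF i(1,2) A \<tau>, of Y] Y by (intro arg_cong[where f = real]) auto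
    then have "real (n i) * (fact (n i) * real (K i) * ?card)
        = (\<Sum>\<rho>\<in>?P. real (K i) * h \<tau> \<rho> Y) * (n i choose \<kappa> \<tau> i)"
      unfolding sum_distrib_left[symmetric] by (simp add: mult_ac)
    also have "\<dots> \<le> (\<Sum>\<rho>\<in>?P. real (n i) * (\<Sum>r<K i. c \<tau> \<rho> r Y)) * (n i choose \<kappa> \<tau> i)"
      using one[OF \<tau>] by (intro mult_right_mono sum_mono) auto
    also have "\<dots> = real (n i) * (\<Sum>\<rho>\<in>?P. \<Sum>r<K i. real (n i choose \<kappa> \<tau> i) * c \<tau> \<rho> r Y)"
      by (simp add: sum_distrib_left sum_distrib_right mult_ac)
    finally show ?thesis using npos by simp
  qed
  have "fact (n i) * real (K i) * W D A = (\<Sum>\<tau>\<in>T. \<Sum>Y\<in>Pow (X - B i).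
      weight D \<tau> Y * (fact (n i) * real (K i) * card {S. S \<subseteq> B i \<and> S \<union> Y \<in> A \<tau>}))"
    unfolding W_def
    by (simp add: sum_weight_fibres[OF i A] sum_distrib_left mult_ac cong: sum.cong)
  also have "\<dots> \<le> (\<Sum>\<tau>\<in>T. \<Sum>Y\<in>Pow (X - B i).
      weight D \<tau> Y * (\<Sum>\<rho>\<in>?P. \<Sum>r<K i. real (n i choose \<kappa> \<tau> i) * c \<tau> \<rho> r Y))"
    using fibre weight_nonneg i by (intro sum_mono mult_left_mono) auto
  also have "\<dots> = (\<Sum>\<tau>\<in>T. \<Sum>\<rho>\<in>?P. \<Sum>r<K i. \<Sum>Y\<in>Pow (X - B i).
      weight D \<tau> Y * (real (n i choose \<kappa> \<tau> i) * c \<tau> \<rho> r Y))"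
    unfolding sum_distrib_left
    by (rule sum.cong[OF refl], subst sum.swap, rule sum.cong[OF refl], rule sum.swap)
  also have "\<dots> = (\<Sum>\<tau>\<in>T. \<Sum>\<rho>\<in>?P. \<Sum>r<K i. \<Sum>F\<in>process i (\<rho> \<circ> \<sigma> i) r A \<tau>. weight (insert i D) \<tau> F)"
    unfolding sum_weight_process[OF i] c_def h_def ..
  also have "\<dots> = (\<Sum>\<rho>\<in>?P. \<Sum>r<K i. W (insert i D) (process i (\<rho> \<circ> \<sigma> i) r A))"
    unfolding W_def by (subst sum.swap, rule sum.cong[OF refl], rule sum.swap)
  finally show ?thesis .
qed

lemma W_final_le:
  assumes A: "valid I A" "cross_meeting A" and M: "\<And>i. i \<in> I \<Longrightarrow> star_weight i \<le> M" "0 \<le> M"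
  shows "W I A \<le> M"
    and "(\<And>\<tau> i. \<tau> \<in> T \<Longrightarrow> i \<in> I \<Longrightarrow> {x i} \<notin> A \<tau>) \<Longrightarrow> W I A \<le> 2/3 * M"
proof -
  define R where "R = x ` I"
  define \<B> where "\<B> = (\<Union>\<tau>\<in>T. A \<tau>)"
  have inj: "inj_on x I"
  proof (rule inj_onI, rule ccontr)
    fix i j assume ij: "i \<in> I" "j \<in> I" "x i = x j" "i \<noteq> j"
    then have "x i \<in> B i \<inter> B j" using x_in[of i] x_in[of j] by simp
    then show False using disjoint_blocks[of i j] ij by simp
  qed
  have cardR: "card R = card I" unfolding R_def by (rule card_image[OF inj])
  have finR: "finite R" using finite_I by (simp add: R_def)
  have \<B>: "\<B> \<subseteq> Pow R"
  proof
    fix F assume "F \<in> \<B>"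
    then obtain \<tau> where "\<tau> \<in> T" "F \<in> A \<tau>" by (auto simp: \<B>_def)
    then have "F \<subseteq> X" "\<forall>i\<in>I. F \<inter> B i \<subseteq> {x i}" using A(1) unfolding valid_def by auto
    then show "F \<in> Pow R" by (fastforce simp: X_def R_def)
  qed
  have int: "intersecting \<B>" using A(2) unfolding \<B>_def intersecting_def cross_meeting_def by blast
  have fin\<B>: "finite \<B>" using \<B> finR finite_subset by blast
  obtain \<theta> :: "'a \<Rightarrow> real" where \<theta>: "\<And>j. 0 \<le> \<theta> j" "sum \<theta> R \<le> 1"
    "\<forall>j. {j} \<notin> \<B> \<Longrightarrow> sum \<theta> R \<le> 2/3"
    "\<And>q. \<forall>j\<in>R. 0 \<le> q j \<and> 3 * real (card R) * q j \<le> 1 \<Longrightarrow>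
       (\<Sum>b\<in>\<B>. bits_weight R q b) \<le> (\<Sum>j\<in>R. \<theta> j * q j)"
    using intersecting_bits_bound[OF finR \<B> int] by auto
  define N where "N \<tau> = (\<Prod>j\<in>I. real (n j choose \<kappa> \<tau> j))" for \<tau>
  define p where "p \<tau> y = q \<tau> (inv_into I x y)" for \<tau> y
  have p: "p \<tau> (x i) = q \<tau> i" if "i \<in> I" for \<tau> i using inj that by (simp add: p_def)
  have w: "weight I \<tau> F = N \<tau> * bits_weight R (p \<tau>) F" for \<tau> F
    unfolding weight_def N_def bits_weight_def R_def prod.distrib prod.reindex[OF inj]
    by (intro arg_cong2[where f = "(*)"] prod.cong) (auto simp: p)
  have q3: "3 * real (card I) * q \<tau> i \<le> 1" if "\<tau> \<in> T" "i \<in> I" for \<tau> i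
  proof -
    have "3 * card I * \<kappa> \<tau> i \<le> n i"
      using \<kappa>_le[OF that] b_le[OF that(2)] by (meson le_trans mult_le_mono2)
    then have "real (3 * card I * \<kappa> \<tau> i) \<le> real (n i)" by (rule of_nat_mono)
    then show ?thesis using n_pos[OF that(2)] by (simp add: field_simps)
  qed
  have "(\<Sum>F\<in>A \<tau>. weight I \<tau> F) \<le> N \<tau> * (\<Sum>i\<in>I. \<theta> (x i) * q \<tau> i)" if \<tau>: "\<tau> \<in> T" for \<tau>
  proof -
    have "(\<Sum>F\<in>A \<tau>. weight I \<tau> F) \<le> (\<Sum>F\<in>\<B>. weight I \<tau> F)"
      using fin\<B> \<tau> weight_nonneg by (intro sum_mono2) (auto simp: \<B>_def)
    also have "\<dots> = N \<tau> * (\<Sum>F\<in>\<B>. bits_weight R (p \<tau>) F)" by (simp add: w sum_distrib_left)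
    also have "\<dots> \<le> N \<tau> * (\<Sum>j\<in>R. \<theta> j * p \<tau> j)"
    proof (intro mult_left_mono \<theta>(4))
      show "\<forall>j\<in>R. 0 \<le> p \<tau> j \<and> 3 * real (card R) * p \<tau> j \<le> 1"
        using q3[OF \<tau>] p unfolding cardR by (auto simp: R_def)
      show "0 \<le> N \<tau>" unfolding N_def by (intro prod_nonneg) auto
    qed
    also have "(\<Sum>j\<in>R. \<theta> j * p \<tau> j) = (\<Sum>i\<in>I. \<theta> (x i) * q \<tau> i)"
      unfolding R_def sum.reindex[OF inj] by (simp add: p)
    finally show ?thesis .
  qed
  then have "W I A \<le> (\<Sum>\<tau>\<in>T. N \<tau> * (\<Sum>i\<in>I. \<theta> (x i) * q \<tau> i))"
    unfolding W_def by (intro sum_mono)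
  also have "\<dots> = (\<Sum>i\<in>I. \<theta> (x i) * star_weight i)"
    unfolding star_weight_def N_def[symmetric] sum_distrib_left
    by (subst sum.swap) (simp add: mult_ac)
  also have "\<dots> \<le> (\<Sum>i\<in>I. \<theta> (x i) * M)" using M \<theta>(1) by (intro sum_mono mult_left_mono) auto
  also have "\<dots> = sum \<theta> R * M" unfolding R_def sum.reindex[OF inj] by (simp add: sum_distrib_right)
  finally have le: "W I A \<le> sum \<theta> R * M" .
  show "W I A \<le> M" using le mult_right_mono[OF \<theta>(2) M(2)] by simp
  show "W I A \<le> 2/3 * M" if no: "\<And>\<tau> i. \<tau> \<in> T \<Longrightarrow> i \<in> I \<Longrightarrow> {x i} \<notin> A \<tau>"
  proof -
    have "{j} \<notin> \<B>" for j
    proof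
      assume j: "{j} \<in> \<B>"
      then have "j \<in> R" using \<B> by auto
      then show False using j no by (auto simp: R_def \<B>_def)
    qed
    then show ?thesis using le mult_right_mono[OF \<theta>(3) M(2)] by simp
  qed
qed

lemma bij_permuted:
  "i \<in> I \<Longrightarrow> \<rho> permutes B i \<Longrightarrow> bij_betw (\<rho> \<circ> \<sigma> i) {..<n i} (B i)"
  using bij_\<sigma> permutes_imp_bij bij_betw_trans by blast

lemma W_le:
  assumes "valid D A" "cross_meeting A" "D \<subseteq> I"
    and M: "\<And>i. i \<in> I \<Longrightarrow> star_weight i \<le> M" "0 \<le> M"
  shows "W D A \<le> M"
  using assms(1-3)
proof (induction "card (I - D)" arbitrary: D A)
  case 0
  then have "D = I" using finite_I by auto
  then show ?case using W_final_le(1)[OF _ _ M] 0 by simp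
next
  case (Suc m)
  then obtain i where i: "i \<in> I" "i \<notin> D" by (metis Diff_iff card.empty equals0I nat.distinct(1))
  have m: "m = card (I - insert i D)"
    using Suc(2) i finite_I by (subst Diff_insert) (simp add: card_Diff_singleton)
  have "fact (n i) * real (K i) * W D A
      \<le> (\<Sum>\<rho> | \<rho> permutes B i. \<Sum>r<K i. W (insert i D) (process i (\<rho> \<circ> \<sigma> i) r A))"
    by (rule W_step[OF i Suc(5,3)])
  also have "\<dots> \<le> (\<Sum>\<rho> | \<rho> permutes B i. \<Sum>r<K i. M)"
    using Suc i by (intro sum_mono Suc(1)[OF m] valid_process cross_meeting_process bij_permuted) auto
  also have "\<dots> = fact (n i) * real (K i) * M"
    using card_permutations[OF refl finite_B[OF i(1)]] by simp
  finally show ?case using K_bounds(1)[OF i(1)] by simp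
qed

text \<open>Averaging loses something as soon as the branch \<open>\<rho> = id\<close>, \<open>r = r0\<close> does; the predicate \<open>P\<close>
  is an invariant followed along this branch only.\<close>

lemma W_less:
  assumes "valid D A" "cross_meeting A" "D \<subseteq> I" "P D A"
    and M: "\<And>i. i \<in> I \<Longrightarrow> star_weight i \<le> M" "0 < M"
    and r0: "\<And>i. i \<in> I \<Longrightarrow> r0 i < K i"
    and step: "\<And>D A i. valid D A \<Longrightarrow> D \<subseteq> I \<Longrightarrow> P D A \<Longrightarrow> i \<in> I - D \<Longrightarrow> P (insert i D) (process i (\<sigma> i) (r0 i) A)"
    and final: "\<And>A \<tau> i. P I A \<Longrightarrow> \<tau> \<in> T \<Longrightarrow> i \<in> I \<Longrightarrow> {x i} \<notin> A \<tau>"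
  shows "W D A < M"
  using assms(1-4)
proof (induction "card (I - D)" arbitrary: D A)
  case 0
  then have "D = I" using finite_I by auto
  then have "W D A \<le> 2/3 * M" using W_final_le(2)[OF _ _ M(1)] M(2) 0 final by auto
  then show ?case using M(2) by simp
next
  case (Suc m)
  then obtain i where i: "i \<in> I" "i \<notin> D" by (metis Diff_iff card.empty equals0I nat.distinct(1))
  have m: "m = card (I - insert i D)"
    using Suc(2) i finite_I by (subst Diff_insert) (simp add: card_Diff_singleton)
  let ?w = "\<lambda>\<rho> r. W (insert i D) (process i (\<rho> \<circ> \<sigma> i) r A)"
  have le: "?w \<rho> r \<le> M" if "\<rho> permutes B i" for \<rho> r
    using Suc i M that by (intro W_le valid_process cross_meeting_process bij_permuted) auto
  have id: "id permutes B i" by (rule permutes_id)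
  have less: "?w id (r0 i) < M"
    using Suc i step[OF Suc(3,5,6), of i]
    by (intro Suc(1)[OF m] valid_process cross_meeting_process bij_permuted[OF _ id]) auto
  have fin: "finite {\<rho>. \<rho> permutes B i}" using finite_permutations[OF finite_B[OF i(1)]] .
  have "fact (n i) * real (K i) * W D A
      \<le> (\<Sum>\<rho> | \<rho> permutes B i. \<Sum>r<K i. ?w \<rho> r)"
    by (rule W_step[OF i Suc(5,3)])
  also have "\<dots> < (\<Sum>\<rho> | \<rho> permutes B i. \<Sum>r<K i. M)"
  proof (rule sum_strict_mono_ex1[OF fin])
    show "\<forall>\<rho>\<in>{\<rho>. \<rho> permutes B i}. (\<Sum>r<K i. ?w \<rho> r) \<le> (\<Sum>r<K i. M)"
      using le by (intro ballI sum_mono) simp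
    have "(\<Sum>r<K i. ?w id r) < (\<Sum>r<K i. M)"
      using le[OF id] less r0[OF i(1)] by (intro sum_strict_mono_ex1) auto
    then show "\<exists>\<rho>\<in>{\<rho>. \<rho> permutes B i}. (\<Sum>r<K i. ?w \<rho> r) < (\<Sum>r<K i. M)"
      using id by blast
  qed
  also have "\<dots> = fact (n i) * real (K i) * M"
    using card_permutations[OF refl finite_B[OF i(1)]] by simp
  finally show ?case using K_bounds(1)[OF i(1)] by simp
qed

end

section \<open>Placements on a cycle\<close>

text \<open>Used to exclude common arcs: \<open>v - u\<close> and \<open>n - (v - u)\<close> are the
  two distances along the cycle, and one of them must be shorter than the arc.\<close>

lemma arc_dist:
  assumes "u \<in> arc n t k" "v \<in> arc n t k" "u \<le> v" "k \<le> n"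
  shows "v - u < k \<or> n - (v - u) < k"
proof -
  obtain i j where ij: "i < k" "j < k" "u = (t + i) mod n" "v = (t + j) mod n"
    using assms by (auto simp: arc_def)
  then have n: "0 < n" "u < n" "v < n" using assms by auto
  show ?thesis
  proof (cases "i \<le> j")
    case True
    have "(u + (j - i)) mod n = (t + i + (j - i)) mod n" unfolding ij(3) by (rule mod_add_left_eq)
    then have v: "v = (u + (j - i)) mod n" using True ij(4) by simp
    show ?thesis
    proof (cases "u + (j - i) < n")
      case True
      then have "v = u + (j - i)" using v by simp
      then show ?thesis using ij(2) by linarith
    next
      case False
      have lt: "j - i < n" using ij(2) assms(4) by linarith
      have "v = (u + (j - i) - n) mod n" unfolding v using False by (intro le_mod_geq) simp
      also have "\<dots> = u + (j - i) - n" using n lt by (intro mod_less) linarith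
      finally show ?thesis using assms(3) n lt False by linarith
    qed
  next
    case False
    have "(v + (i - j)) mod n = (t + j + (i - j)) mod n" unfolding ij(4) by (rule mod_add_left_eq)
    then have u: "u = (v + (i - j)) mod n" using False ij(3) by simp
    show ?thesis
    proof (cases "v + (i - j) < n")
      case True
      then have "u = v + (i - j)" using u by simp
      then show ?thesis using assms(3) False by linarith
    next
      case F: False
      have lt: "i - j < n" using ij(1) assms(4) by linarith
      have "u = (v + (i - j) - n) mod n" unfolding u using F by (intro le_mod_geq) simp
      also have "\<dots> = v + (i - j) - n" using n lt by (intro mod_less) linarith
      finally show ?thesis using ij(1) n F False by linarith
    qed
  qed
qed

lemma card_meeting_arcs:
  assumes "0 < n"
  shows "card {t. t < n \<and> arc n t k \<inter> arc n c l \<noteq> {}} \<le> k + l - 1"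
proof (cases "k = 0 \<or> l = 0")
  case False
  \<comment> \<open>The possible starts run from \<open>c - (k - 1)\<close> to
    \<open>c + l - 1\<close>. Adding \<open>n * k\<close>, a multiple of the modulus, keeps the
    subtraction on naturals from truncating.\<close>
  have "{t. t < n \<and> arc n t k \<inter> arc n c l \<noteq> {}} \<subseteq> (\<lambda>d. (c + n * k + d - (k - 1)) mod n) ` {..<k + l - 1}"
  proof
    fix t assume "t \<in> {t. t < n \<and> arc n t k \<inter> arc n c l \<noteq> {}}"
    then obtain i j where t: "t < n" "i < k" "j < l" "(t + i) mod n = (c + j) mod n"
      by (auto simp: arc_def)
    have "k \<le> n * k" using assms by simp
    then have e: "c + n * k + (j + (k - 1 - i)) - (k - 1) = c + j + n * k - i" using t by linarith
    have "c + j + n * k - i + i = c + j + n * k" using t \<open>k \<le> n * k\<close> by linarith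
    then have "(c + j + n * k - i + i) mod n = (t + i) mod n" using t by simp
    then have "(i + (c + j + n * k - i)) mod n = (i + t) mod n" by (simp add: add.commute)
    then have "(i + (c + j + n * k - i) mod n) mod n = (i + t) mod n" by (simp only: mod_add_right_eq)
    from add_mod_cancel[OF this] have "(c + j + n * k - i) mod n = t" using t(1) assms by simp
    then have "t = (c + n * k + (j + (k - 1 - i)) - (k - 1)) mod n" unfolding e by simp
    moreover have "j + (k - 1 - i) \<in> {..<k + l - 1}" using t by auto
    ultimately show "t \<in> (\<lambda>d. (c + n * k + d - (k - 1)) mod n) ` {..<k + l - 1}" by blast
  qed
  then show ?thesis using surj_card_le[OF finite_lessThan] by fastforce
qed auto

lemma extend_injection:
  assumes S: "finite S" "Q \<subseteq> S" and g: "inj_on g Q" "g ` Q \<subseteq> S"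
  obtains \<gamma> where "bij_betw \<gamma> S S" "\<And>y. y \<in> Q \<Longrightarrow> \<gamma> y = g y"
proof -
  have finQ: "finite Q" using S finite_subset by auto
  have "card (S - Q) = card (S - g ` Q)"
    using S g finQ by (simp add: card_Diff_subset card_image)
  then obtain h where h: "bij_betw h (S - Q) (S - g ` Q)"
    using S finite_same_card_bij by (metis finite_Diff)
  define \<gamma> where "\<gamma> y = (if y \<in> Q then g y else h y)" for y
  have "bij_betw \<gamma> Q (g ` Q)" using g by (auto simp: bij_betw_def \<gamma>_def inj_on_def)
  moreover have "bij_betw \<gamma> (S - Q) (S - g ` Q)"
    using h by (rule bij_betw_cong[THEN iffD1, rotated]) (simp add: \<gamma>_def)
  ultimately have "bij_betw \<gamma> (Q \<union> (S - Q)) (g ` Q \<union> (S - g ` Q))"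
    by (rule bij_betw_combine) auto
  then have "bij_betw \<gamma> S S" using S g by (simp add: Un_absorb1)
  then show ?thesis by (rule that) (simp add: \<gamma>_def)
qed

lemma extend_placement:
  assumes "Q \<subseteq> {..<n}" "inj_on g Q" "g ` Q \<subseteq> {..<n::nat}"
  obtains \<pi> where "bij_betw \<pi> {..<n} {..<n}" "\<And>r. r \<in> Q \<Longrightarrow> \<pi> (g r) = r"
proof -
  obtain \<gamma> where \<gamma>: "bij_betw \<gamma> {..<n} {..<n}" "\<And>y. y \<in> Q \<Longrightarrow> \<gamma> y = g y"
    using extend_injection[OF _ assms] by auto
  show ?thesis
  proof (rule that)
    \<comment> \<open>\<open>g\<close> prescribes a position for each rank, whereas
      \<open>\<pi>\<close> reads off the rank at a position; hence the inverse.\<close>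
    show "bij_betw (inv_into {..<n} \<gamma>) {..<n} {..<n}" using \<gamma>(1) by (rule bij_betw_inv_into)
    show "inv_into {..<n} \<gamma> (g r) = r" if "r \<in> Q" for r
      using \<gamma> that assms by (metis bij_betw_inv_into_left subsetD)
  qed
qed

text \<open>The ranks \<open>2 s + 1\<close> and \<open>2 s + 2\<close> are put on distant stretches, so that a short arc contains at
  most one of them; rank \<open>0\<close> is put far from all small ranks.\<close>

definition spread :: "nat \<Rightarrow> nat \<Rightarrow> (nat \<Rightarrow> nat) \<Rightarrow> bool" where
  "spread n b \<pi> \<longleftrightarrow> bij_betw \<pi> {..<n} {..<n} \<and>
    (\<forall>t k. k \<le> b \<longrightarrow> 0 \<in> \<pi> ` arc n t k \<longrightarrow> \<pi> ` arc n t k \<inter> {1..2 * b} = {}) \<and>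
    (\<forall>t k m. k \<le> b \<longrightarrow> 0 \<notin> \<pi> ` arc n t k \<longrightarrow> 2 * card (\<pi> ` arc n t k \<inter> {..<m}) \<le> m) \<and>
    (\<forall>k\<le>b. card {t. t < n \<and> \<pi> ` arc n t k \<inter> {..<b} \<noteq> {}} < k + (n - b))"

text \<open>For \<open>s < b\<close>, rank \<open>2 * s + 1\<close> is put at position
  \<open>s\<close>, rank \<open>2 * s + 2\<close> at \<open>2 * b + s\<close>, and rank 0 at
  \<open>4 * b\<close>. By \<open>6 * b \<le> n\<close> the gaps between these three stretches, also
  around the cycle, are so wide that no arc of length at most \<open>b\<close> meets two of
  them.\<close>

lemma spread_exists:
  fixes n b :: nat
  assumes n: "0 < n" "6 * b \<le> n"
  shows "\<exists>\<pi>. spread n b \<pi>"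
proof -
  define g where "g r = (if r = 0 then 4 * b else if odd r then r div 2 else 2 * b + (r div 2 - 1))" for r :: nat
  have g: "g 0 = 4 * b" "g (2 * s + 1) = s" "g (2 * s + 2) = 2 * b + s" for s
    by (auto simp: g_def)
  have cases: "r = 0 \<or> (\<exists>s<b. r = 2 * s + 1) \<or> (\<exists>s<b. r = 2 * s + 2)" if "r \<in> {..2 * b}" for r
  proof (cases "odd r")
    case True
    then obtain s where "r = 2 * s + 1" by (auto elim: oddE)
    then show ?thesis using that by auto
  next
    case False
    then obtain s where "r = 2 * s" by (auto elim: evenE)
    then show ?thesis using that by (cases s) auto
  qed
  have "inj_on g {..2 * b}"
  proof (rule inj_onI)
    fix r r' assume "r \<in> {..2 * b}" "r' \<in> {..2 * b}" "g r = g r'"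
    then show "r = r'" using cases[of r] cases[of r'] g by auto
  qed
  moreover have "g ` {..2 * b} \<subseteq> {..<n}"
  proof
    fix y assume "y \<in> g ` {..2 * b}"
    then obtain r where r: "r \<in> {..2 * b}" "y = g r" by blast
    have b: "4 * b < n" using n by linarith
    show "y \<in> {..<n}" using cases[OF r(1)] r(2) b by (elim disjE exE conjE) (simp_all only: g, auto)
  qed
  moreover have "{..2 * b} \<subseteq> {..<n}" using n by auto
  ultimately obtain \<pi> where \<pi>: "bij_betw \<pi> {..<n} {..<n}" "\<And>r. r \<in> {..2 * b} \<Longrightarrow> \<pi> (g r) = r"
    using extend_placement by metis
  have pos: "g r \<in> arc n t k" if r: "r \<in> \<pi> ` arc n t k" "r \<in> {..2 * b}" for r t k
  proof -
    obtain u where u: "u \<in> arc n t k" "r = \<pi> u" using r(1) by auto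
    have "g r < n" using \<open>g ` {..2 * b} \<subseteq> {..<n}\<close> r by auto
    moreover have "\<pi> (g r) = \<pi> u" using \<pi>(2) r u by simp
    ultimately have "g r = u" using \<pi>(1) u arc_subset[OF n(1), of t k] by (auto simp: bij_betw_def inj_on_def)
    then show ?thesis using u by simp
  qed
  have kn: "k \<le> n" if "k \<le> b" for k using that n by linarith
  show ?thesis
    unfolding spread_def
  proof (intro exI[of _ \<pi>] conjI allI impI \<pi>(1))
    fix t k assume k: "k \<le> b" and z: "0 \<in> \<pi> ` arc n t k"
    have p0: "4 * b \<in> arc n t k" using pos[OF z] g by simp
    show "\<pi> ` arc n t k \<inter> {1..2 * b} = {}"
    proof (rule ccontr)
      assume "\<pi> ` arc n t k \<inter> {1..2 * b} \<noteq> {}"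
      then obtain r where r: "r \<in> \<pi> ` arc n t k" "1 \<le> r" "r \<le> 2 * b" by (metis IntE atLeastAtMost_iff ex_in_conv)
      have gr: "g r \<in> arc n t k" using pos[OF r(1)] r by simp
      have "g r \<le> 3 * b - 1 \<and> 1 \<le> b" using cases[of r] r g by auto
      then show False using arc_dist[OF gr p0 _ kn[OF k]] k n by linarith
    qed
  next
    fix t k m assume k: "k \<le> b" and z: "0 \<notin> \<pi> ` arc n t k"
    have pair: "\<not> (2 * s + 1 \<in> \<pi> ` arc n t k \<and> 2 * s + 2 \<in> \<pi> ` arc n t k)" if s: "s < b" for s
    proof
      assume h: "2 * s + 1 \<in> \<pi> ` arc n t k \<and> 2 * s + 2 \<in> \<pi> ` arc n t k"
      have "s \<in> arc n t k" "2 * b + s \<in> arc n t k"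
        using pos[of "2 * s + 1" t k] pos[of "2 * s + 2" t k] h s g by auto
      from arc_dist[OF this _ kn[OF k]] show False using k n s by linarith
    qed
    show "2 * card (\<pi> ` arc n t k \<inter> {..<m}) \<le> m"
    proof (cases "2 * b \<le> m")
      case True
      have fin: "finite (arc n t k)" by (simp add: arc_def)
      have "card (\<pi> ` arc n t k \<inter> {..<m}) \<le> card (\<pi> ` arc n t k)" using fin by (intro card_mono) auto
      also have "\<dots> \<le> card (arc n t k)" using fin by (rule card_image_le)
      also have "\<dots> = k" using card_arc kn[OF k] by simp
      finally show ?thesis using True k by linarith
    next
      case False
      \<comment> \<open>The map numbers the pairs of ranks \<open>2 * s + 1\<close>,
        \<open>2 * s + 2\<close>, and the arc contains at most one rank of each pair.\<close>
      have "card (\<pi> ` arc n t k \<inter> {..<m}) \<le> card {..<m div 2}"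
      proof (rule card_inj_on_le[where f = "\<lambda>r. (r - 1) div 2"])
        show "inj_on (\<lambda>r. (r - 1) div 2) (\<pi> ` arc n t k \<inter> {..<m})"
        proof (rule inj_onI, rule ccontr)
          fix r r' assume h: "r \<in> \<pi> ` arc n t k \<inter> {..<m}" "r' \<in> \<pi> ` arc n t k \<inter> {..<m}"
            "(r - 1) div 2 = (r' - 1) div 2" "r \<noteq> r'"
          have nz: "r \<noteq> 0" "r' \<noteq> 0" using h(1,2) z by (auto intro: gr0I)
          define s where "s = (r - 1) div 2"
          have "(r = 2 * s + 1 \<and> r' = 2 * s + 2 \<or> r = 2 * s + 2 \<and> r' = 2 * s + 1) \<and> s < b"
          proof -
            have "r = 2 * s + 1 + (r - 1) mod 2" "r' = 2 * s + 1 + (r' - 1) mod 2"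
              using nz h(3) div_mult_mod_eq[of "r - 1" 2] div_mult_mod_eq[of "r' - 1" 2]
              unfolding s_def by linarith+
            moreover have "(r - 1) mod 2 < 2" "(r' - 1) mod 2 < 2" by simp_all
            moreover have "r < m" "r' < m" using h by auto
            ultimately show ?thesis using h(4) False by linarith
          qed
          then show False using pair[of s] IntD1[OF h(1)] IntD1[OF h(2)] by metis
        qed
        show "(\<lambda>r. (r - 1) div 2) ` (\<pi> ` arc n t k \<inter> {..<m}) \<subseteq> {..<m div 2}"
        proof
          fix y assume "y \<in> (\<lambda>r. (r - 1) div 2) ` (\<pi> ` arc n t k \<inter> {..<m})"
          then obtain r where r: "r \<in> \<pi> ` arc n t k" "r < m" "y = (r - 1) div 2" by blast
          have "r \<noteq> 0" using r z by metis
          then show "y \<in> {..<m div 2}" using r by simp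
        qed
      qed simp
      then show ?thesis by simp
    qed
  next
    fix k assume k: "k \<le> b"
    show "card {t. t < n \<and> \<pi> ` arc n t k \<inter> {..<b} \<noteq> {}} < k + (n - b)"
    proof (cases "k = 0")
      case True
      then show ?thesis using n by simp
    next
      case False
      let ?m = "\<lambda>c l. {t. t < n \<and> arc n t k \<inter> arc n c l \<noteq> {}}"
      have a: "s \<in> arc n 0 b" "2 * b + s \<in> arc n (2 * b) b" if "s < b" for s
        using that n by (auto simp: arc_def)
      have a4: "4 * b \<in> arc n (4 * b) 1" using n k False by (auto simp: arc_def)
      have "{t. t < n \<and> \<pi> ` arc n t k \<inter> {..<b} \<noteq> {}} \<subseteq> ?m 0 b \<union> ?m (2 * b) b \<union> ?m (4 * b) 1"
      proof
        fix t assume "t \<in> {t. t < n \<and> \<pi> ` arc n t k \<inter> {..<b} \<noteq> {}}"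
        then obtain r where r: "t < n" "r \<in> \<pi> ` arc n t k" "r < b" by auto
        have "g r \<in> arc n t k" using pos[OF r(2)] r by simp
        moreover have "g r \<in> arc n 0 b \<union> arc n (2 * b) b \<union> arc n (4 * b) 1"
          using cases[of r] r a a4 g by auto
        ultimately show "t \<in> ?m 0 b \<union> ?m (2 * b) b \<union> ?m (4 * b) 1" using r by blast
      qed
      then have "card {t. t < n \<and> \<pi> ` arc n t k \<inter> {..<b} \<noteq> {}} \<le> card (?m 0 b \<union> ?m (2 * b) b \<union> ?m (4 * b) 1)"
        by (intro card_mono) auto
      also have "\<dots> \<le> card (?m 0 b) + card (?m (2 * b) b) + card (?m (4 * b) 1)"
        by (meson add_le_mono1 card_Un_le le_trans)
      \<comment> \<open>One window of starting points per stretch. The total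
        \<open>3 * k + 2 * b - 2\<close> is at most \<open>k + 4 * b - 2\<close>, which is below
        \<open>k + (n - b)\<close> because \<open>6 * b \<le> n\<close>.\<close>
      also have "\<dots> \<le> (k + b - 1) + (k + b - 1) + (k + 1 - 1)"
        using n by (intro add_mono card_meeting_arcs)
      finally show ?thesis using n k False by linarith
    qed
  qed
qed

section \<open>Shifted families\<close>

locale quota =
  fixes p k :: nat and B :: "nat \<Rightarrow> 'a set" and a :: "nat \<Rightarrow> nat" and rk :: "'a \<Rightarrow> nat"
  assumes p: "1 \<le> p"
    and finite_B: "i \<in> {1..p} \<Longrightarrow> finite (B i)"
    and disjoint_B: "disjoint_family_on B {1..p}"
    and nonempty_B: "i \<in> {1..p} \<Longrightarrow> B i \<noteq> {}"
    and k: "1 \<le> k" and sum_a: "(\<Sum>i\<in>{1..p}. a i) \<le> k"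
    and large: "i \<in> {1..p} \<Longrightarrow> 3 * p * (k - (\<Sum>j\<in>{1..p}. a j) + a i) \<le> card (B i)"
    and rk: "i \<in> {1..p} \<Longrightarrow> bij_betw rk (B i) {..<card (B i)}"
begin

abbreviation I :: "nat set" where "I \<equiv> {1..p}"

definition X :: "'a set" where "X = (\<Union>i\<in>I. B i)"

abbreviation \<G> :: "'a set set" where "\<G> \<equiv> bounded_family p B a k"

text \<open>Bounds the size of a member inside block \<open>i\<close>, since the other blocks take
  at least their quotas.\<close>

definition b :: "nat \<Rightarrow> nat" where "b i = k - (\<Sum>j\<in>I. a j) + a i"

text \<open>The value 0 outside \<open>I\<close> makes types equal as functions as soon as the block
  sizes agree.\<close>

definition type :: "'a set \<Rightarrow> nat \<Rightarrow> nat" where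
  "type F i = (if i \<in> I then card (F \<inter> B i) else 0)"

abbreviation T :: "(nat \<Rightarrow> nat) set" where "T \<equiv> type ` \<G>"

definition first :: "nat \<Rightarrow> 'a" where "first i = inv_into (B i) rk 0"

definition stable :: "'a set set \<Rightarrow> bool" where
  "stable A \<longleftrightarrow> (\<forall>F\<in>A. \<forall>i\<in>I. \<forall>u\<in>B i. \<forall>v\<in>B i.
     rk u < rk v \<longrightarrow> v \<in> F \<longrightarrow> u \<notin> F \<longrightarrow> insert u (F - {v}) \<in> A)"

text \<open>Drops with every exchange towards a smaller rank. It selects extremal members and
  measures the progress of shifting.\<close>

definition potential :: "'a set \<Rightarrow> nat" where "potential F = (\<Sum>y\<in>F. rk y)"

lemma finite_X: "finite X"
  using finite_B by (auto simp: X_def)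

lemma \<G>_iff: "F \<in> \<G> \<longleftrightarrow> F \<subseteq> X \<and> card F = k \<and> (\<forall>i\<in>I. a i \<le> card (F \<inter> B i))"
  by (simp add: bounded_family_def X_def)

lemma finite_\<G>: "finite \<G>"
  using finite_X by (rule_tac finite_subset[of _ "Pow X"]) (auto simp: \<G>_iff)

lemma finite_member: "F \<in> \<G> \<Longrightarrow> finite F"
  using finite_X finite_subset by (auto simp: \<G>_iff)

lemma blocks_disjoint: "i \<in> I \<Longrightarrow> j \<in> I \<Longrightarrow> i \<noteq> j \<Longrightarrow> B i \<inter> B j = {}"
  using disjoint_B by (auto simp: disjoint_family_on_def)

lemma block_subset: "i \<in> I \<Longrightarrow> B i \<subseteq> X"
  by (auto simp: X_def)

lemma card_eq_sum_blocks:
  assumes "F \<subseteq> X"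
  shows "card F = (\<Sum>i\<in>I. card (F \<inter> B i))"
proof -
  have "F = (\<Union>i\<in>I. F \<inter> B i)" using assms by (auto simp: X_def)
  then have "card F = card (\<Union>i\<in>I. F \<inter> B i)" by simp
  also have "\<dots> = (\<Sum>i\<in>I. card (F \<inter> B i))"
    using finite_B blocks_disjoint by (intro card_UN_disjoint) (auto, blast+)
  finally show ?thesis .
qed

lemma card_block_le:
  assumes F: "F \<in> \<G>" and i: "i \<in> I"
  shows "card (F \<inter> B i) \<le> b i"
proof -
  have "k = (\<Sum>j\<in>I. card (F \<inter> B j))" using F card_eq_sum_blocks[of F] by (simp add: \<G>_iff)
  also have "\<dots> = card (F \<inter> B i) + (\<Sum>j\<in>I - {i}. card (F \<inter> B j))"
    using i by (simp add: sum.remove)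
  finally have "k = card (F \<inter> B i) + (\<Sum>j\<in>I - {i}. card (F \<inter> B j))" .
  moreover have "(\<Sum>j\<in>I - {i}. a j) \<le> (\<Sum>j\<in>I - {i}. card (F \<inter> B j))"
    using F by (intro sum_mono) (simp add: \<G>_iff)
  moreover have "(\<Sum>j\<in>I. a j) = a i + (\<Sum>j\<in>I - {i}. a j)" using i by (simp add: sum.remove)
  ultimately show ?thesis using sum_a unfolding b_def by linarith
qed

lemma card_B_pos: "i \<in> I \<Longrightarrow> 0 < card (B i)"
  using finite_B nonempty_B by (simp add: card_gt_0_iff)

lemma first: "i \<in> I \<Longrightarrow> first i \<in> B i \<and> rk (first i) = 0"
  using rk[of i] card_B_pos[of i] unfolding first_def
  by (auto simp: bij_betw_def intro!: inv_into_into f_inv_into_f)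

lemma rk_inj: "i \<in> I \<Longrightarrow> u \<in> B i \<Longrightarrow> v \<in> B i \<Longrightarrow> rk u = rk v \<longleftrightarrow> u = v"
  using rk[of i] by (auto simp: bij_betw_def inj_on_def)

lemma card_rk_image:
  assumes "i \<in> I" "S \<subseteq> B i"
  shows "card (rk ` S) = card S"
  using rk[OF assms(1)] assms(2) by (intro card_image) (auto simp: bij_betw_def inj_on_def)

lemma card_rk_interval:
  assumes "i \<in> I" "R \<subseteq> {..<card (B i)}"
  shows "card {y \<in> B i. rk y \<in> R} = card R"
proof -
  have "R \<subseteq> rk ` B i" using rk[OF assms(1)] assms(2) by (simp add: bij_betw_def)
  then have "rk ` {y \<in> B i. rk y \<in> R} = R" by blast
  then show ?thesis using card_rk_image[OF assms(1), of "{y \<in> B i. rk y \<in> R}"] by auto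
qed

lemma potential_shift:
  assumes "finite F" "v \<in> F" "u \<notin> F" "rk u < rk v"
  shows "potential (insert u (F - {v})) < potential F"
  using assms by (auto simp: potential_def sum.remove)

text \<open>Take a member avoiding \<open>first i\<close> of least potential.\<close>

lemma stable_compressed_member:
  assumes A: "stable A" "A \<subseteq> \<G>" and i: "i \<in> I" and F: "F \<in> A" "first i \<notin> F"
  obtains G where "G \<in> A" "\<And>j y. j \<in> I \<Longrightarrow> j \<noteq> i \<Longrightarrow> y \<in> G \<inter> B j \<Longrightarrow> rk y < b j"
    "\<And>y. y \<in> G \<inter> B i \<Longrightarrow> 1 \<le> rk y \<and> rk y \<le> card (G \<inter> B i)"
proof -
  obtain G where G: "G \<in> A" "first i \<notin> G"
    and least: "\<And>H. H \<in> A \<Longrightarrow> first i \<notin> H \<Longrightarrow> potential G \<le> potential H"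
    using ex_has_least_nat[of "\<lambda>H. H \<in> A \<and> first i \<notin> H" F potential] F by metis
  have G\<G>: "G \<in> \<G>" using G A by auto
  \<comment> \<open>Otherwise an exchange would give a member of smaller potential that still avoids
    \<open>first i\<close>. So \<open>G\<close> occupies an initial segment of the ranks in every
    other block, and in block \<open>i\<close> an initial segment of the positive ranks.\<close>
  have down: "u \<in> G" if "j \<in> I" "y \<in> G \<inter> B j" "u \<in> B j" "rk u < rk y" "u \<noteq> first i" for j y u
  proof (rule ccontr)
    assume u: "u \<notin> G"
    then have "insert u (G - {y}) \<in> A" using A(1) G(1) that unfolding stable_def by blast
    moreover have "first i \<notin> insert u (G - {y})" using G that by auto
    moreover have "potential (insert u (G - {y})) < potential G"
      using potential_shift[OF finite_member[OF G\<G>]] that u by auto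
    ultimately show False using least by fastforce
  qed
  show ?thesis
  proof (rule that[OF G(1)])
    fix j y assume j: "j \<in> I" "j \<noteq> i" and y: "y \<in> G \<inter> B j"
    have rky: "rk y < card (B j)" using rk[OF j(1)] y by (auto simp: bij_betw_def)
    have "{u \<in> B j. rk u \<in> {..rk y}} \<subseteq> G \<inter> B j"
    proof
      fix u assume u: "u \<in> {u \<in> B j. rk u \<in> {..rk y}}"
      have "u \<noteq> first i" using u j first[OF i] blocks_disjoint[OF j(1) i j(2)] by auto
      then show "u \<in> G \<inter> B j" using down[OF j(1) y, of u] u y rk_inj[OF j(1), of u y]
        by (cases "u = y") auto
    qed
    then have "card {u \<in> B j. rk u \<in> {..rk y}} \<le> card (G \<inter> B j)"
      using finite_B[OF j(1)] by (intro card_mono) auto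
    also have "card {u \<in> B j. rk u \<in> {..rk y}} = card {..rk y}"
      using rky by (intro card_rk_interval[OF j(1)]) auto
    finally show "rk y < b j" using card_block_le[OF G\<G> j(1)] by simp
  next
    fix y assume y: "y \<in> G \<inter> B i"
    have rky: "rk y < card (B i)" using rk[OF i] y by (auto simp: bij_betw_def)
    have "y \<noteq> first i" using y G by auto
    then have y1: "1 \<le> rk y" using first[OF i] rk_inj[OF i, of y "first i"] y by auto
    have "{u \<in> B i. rk u \<in> {1..rk y}} \<subseteq> G \<inter> B i"
    proof
      fix u assume u: "u \<in> {u \<in> B i. rk u \<in> {1..rk y}}"
      then have "u \<noteq> first i" using first[OF i] by auto
      then show "u \<in> G \<inter> B i" using down[OF i y, of u] u y rk_inj[OF i, of u y]
        by (cases "u = y") auto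
    qed
    then have "card {u \<in> B i. rk u \<in> {1..rk y}} \<le> card (G \<inter> B i)"
      using finite_B[OF i] by (intro card_mono) auto
    also have "card {u \<in> B i. rk u \<in> {1..rk y}} = card {1..rk y}"
      using rky by (intro card_rk_interval[OF i]) auto
    finally show "1 \<le> rk y \<and> rk y \<le> card (G \<inter> B i)" using y1 by simp
  qed
qed

text \<open>Under the counting condition each element common to \<open>F\<close> and
  \<open>H\<close> in block \<open>i\<close> can be exchanged in \<open>H\<close> for a free element
  of smaller rank, beginning with the lowest one. \<open>F\<close> stays fixed, the condition
  survives, and the potential of \<open>H\<close> drops.\<close>

lemma stable_make_disjoint:
  assumes A: "stable A" "A \<subseteq> \<G>" and i: "i \<in> I" and F: "F \<in> A" and H: "H \<in> A"
    and count: "\<And>m. card {y \<in> F \<inter> B i. rk y < m} + card {y \<in> H \<inter> B i. rk y < m} \<le> m"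
  obtains H' where "H' \<in> A" "H' - B i = H - B i" "F \<inter> H' \<inter> B i = {}"
proof -
  have "\<exists>H'\<in>A. H' - B i = H - B i \<and> F \<inter> H' \<inter> B i = {}"
    using H count
  proof (induction "potential H" arbitrary: H rule: less_induct)
    case less
    show ?case
    proof (cases "F \<inter> H \<inter> B i = {}")
      case False
      then obtain z0 where "z0 \<in> F \<inter> H \<inter> B i" by auto
      then obtain z where z: "z \<in> F \<inter> H \<inter> B i" and least: "\<And>y. y \<in> F \<inter> H \<inter> B i \<Longrightarrow> rk z \<le> rk y"
        using ex_has_least_nat[of "\<lambda>y. y \<in> F \<inter> H \<inter> B i" z0 rk] by auto
      define c where "c S m = {y \<in> S \<inter> B i. rk y < m}" for S m
      have finc: "finite (c S m)" for S m using finite_B[OF i] by (auto simp: c_def)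
      have cnt: "card (c F m) + card (c H m) \<le> m" for m using less(3) by (simp add: c_def)
      have rkz: "rk z < card (B i)" using rk[OF i] z by (auto simp: bij_betw_def)
      \<comment> \<open>Up to rank \<open>rk z\<close> the two sets have at most
        \<open>rk z + 1\<close> elements in total and \<open>z\<close> is counted twice, so they
        cannot cover all \<open>rk z + 1\<close> elements there.\<close>
      have "\<exists>u\<in>B i. rk u < rk z \<and> u \<notin> F \<and> u \<notin> H"
      proof (rule ccontr)
        assume neg: "\<not> ?thesis"
        have "{u \<in> B i. rk u \<in> {..rk z}} \<subseteq> c F (Suc (rk z)) \<union> c H (Suc (rk z))"
        proof
          fix u assume u: "u \<in> {u \<in> B i. rk u \<in> {..rk z}}"
          then have "u = z \<or> rk u < rk z" using rk_inj[OF i, of u z] z by auto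
          then show "u \<in> c F (Suc (rk z)) \<union> c H (Suc (rk z))" using u z neg by (auto simp: c_def)
        qed
        then have "card {u \<in> B i. rk u \<in> {..rk z}} \<le> card (c F (Suc (rk z)) \<union> c H (Suc (rk z)))"
          using finc by (intro card_mono) auto
        moreover have "card {u \<in> B i. rk u \<in> {..rk z}} = card {..rk z}"
          using rkz by (intro card_rk_interval[OF i]) auto
        moreover have "card (c F (Suc (rk z))) + card (c H (Suc (rk z)))
            = card (c F (Suc (rk z)) \<union> c H (Suc (rk z))) + card (c F (Suc (rk z)) \<inter> c H (Suc (rk z)))"
          using finc by (intro card_Un_Int) auto
        moreover have "z \<in> c F (Suc (rk z)) \<inter> c H (Suc (rk z))" using z by (auto simp: c_def)
        then have "1 \<le> card (c F (Suc (rk z)) \<inter> c H (Suc (rk z)))"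
          using finc by (metis One_nat_def Suc_leI card_gt_0_iff empty_iff finite_Int)
        ultimately show False using cnt[of "Suc (rk z)"] by simp
      qed
      then obtain u where u: "u \<in> B i" "rk u < rk z" "u \<notin> F" "u \<notin> H" by blast
      define H1 where "H1 = insert u (H - {z})"
      have H1A: "H1 \<in> A" using A(1) less(2) i u z unfolding stable_def H1_def by blast
      have "potential H1 < potential H" unfolding H1_def
        using potential_shift[OF finite_member, of H z u] A less(2) u z by auto
      moreover have "card {y \<in> F \<inter> B i. rk y < m} + card {y \<in> H1 \<inter> B i. rk y < m} \<le> m" for m
      proof -
        \<comment> \<open>Below \<open>u\<close> nothing is added to \<open>H\<close>; above
          \<open>z\<close> the count is unchanged; in between, \<open>F\<close> and
          \<open>H1\<close> are disjoint because \<open>z\<close> was the lowest common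
          element.\<close>
        consider "m \<le> rk u" | "rk u < m" "m \<le> rk z" | "rk z < m" by linarith
        then have "card (c F m) + card (c H1 m) \<le> m"
        proof cases
          case 1
          then have "c H1 m \<subseteq> c H m" by (auto simp: c_def H1_def)
          then show ?thesis using cnt[of m] card_mono[OF finc] by (meson add_left_mono le_trans)
        next
          case 2
          have "c F m \<inter> c H1 m = {}" using least u 2 by (fastforce simp: c_def H1_def)
          then have "card (c F m) + card (c H1 m) = card (c F m \<union> c H1 m)"
            using finc by (simp add: card_Un_disjoint)
          also have "\<dots> \<le> card {y \<in> B i. rk y \<in> {..<m}}"
            using finite_B[OF i] by (intro card_mono) (auto simp: c_def)
          also have "\<dots> = card {..<m}" using 2 rkz by (intro card_rk_interval[OF i]) auto
          finally show ?thesis by simp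
        next
          case 3
          have "c H1 m = insert u (c H m - {z})" using u z 3 by (auto simp: c_def H1_def)
          moreover have "z \<in> c H m" "u \<notin> c H m" using u z 3 by (auto simp: c_def)
          ultimately have "card (c H1 m) = card (c H m)"
            using finc[of H m] card_Suc_Diff1[of "c H m" z] by (simp add: card_insert_if)
          then show ?thesis using cnt[of m] by simp
        qed
        then show ?thesis by (simp add: c_def)
      qed
      moreover have "H1 - B i = H - B i" using u z by (auto simp: H1_def)
      ultimately show ?thesis using less(1)[of H1] H1A by auto
    qed (use less in auto)
  qed
  then show ?thesis using that by blast
qed

end

section \<open>Tracing singletons back through the processing at the largest thresholds\<close>

context blocks
begin

text \<open>At threshold \<open>K j - 1\<close> a bit 0 certifies at least \<open>m + K j\<close>
  hits, where \<open>m\<close> is the arc length; if \<open>Q\<close> is admissible, one of the hit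
  arcs therefore avoids \<open>Q\<close>.\<close>

definition admissible :: "'i \<Rightarrow> nat \<Rightarrow> 'a set \<Rightarrow> bool" where
  "admissible j m Q \<longleftrightarrow> card {t. t < n j \<and> \<sigma> j ` arc (n j) t m \<inter> Q \<noteq> {}} < m + K j"

text \<open>\<open>robust\<close> traces a singleton \<open>{x i}\<close> of the fully processed family back to the original one: with
  the largest thresholds \<open>r = K j - 1\<close>, all blocks but \<open>i\<close> are almost unconstrained.\<close>

definition spread_member :: "'i set \<Rightarrow> 't \<Rightarrow> 'i \<Rightarrow> ('i \<Rightarrow> 'a set) \<Rightarrow> 'a set \<Rightarrow> bool" where
  "spread_member D \<tau> i Q F \<longleftrightarrow> (\<forall>j\<in>D. j \<noteq> i \<longrightarrow> F \<inter> B j = {}) \<and> (i \<in> D \<longrightarrow> F \<inter> B i \<noteq> {}) \<and>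
     (\<forall>j\<in>I - D. j \<noteq> i \<longrightarrow> F \<inter> B j \<inter> Q j = {}) \<and>
     (\<forall>j\<in>I - D. \<exists>t<n j. F \<inter> B j = \<sigma> j ` arc (n j) t (\<kappa> \<tau> j))"

definition robust :: "'i set \<Rightarrow> ('t \<Rightarrow> 'a set set) \<Rightarrow> bool" where
  "robust D A \<longleftrightarrow> (\<exists>\<tau>\<in>T. \<exists>i\<in>I. \<forall>Q. (\<forall>j\<in>I. admissible j (\<kappa> \<tau> j) (Q j)) \<longrightarrow>
     (\<exists>F\<in>A \<tau>. spread_member D \<tau> i Q F))"

lemma robust_final:
  assumes "\<tau> \<in> T" "i \<in> I" "{x i} \<in> A \<tau>"
  shows "robust I A"
proof -
  have "{x i} \<inter> B j = {}" if "j \<in> I" "j \<noteq> i" for j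
    using disjoint_blocks[OF that(1) assms(2) that(2)] x_in[OF assms(2)] by blast
  moreover have "{x i} \<inter> B i \<noteq> {}" using x_in[OF assms(2)] by blast
  ultimately have "spread_member I \<tau> i Q {x i}" for Q unfolding spread_member_def by blast
  then show ?thesis unfolding robust_def using assms by blast
qed

text \<open>A witness is lifted by restoring block \<open>j\<close> with a hit arc: any one if
  \<open>j = i\<close>, one disjoint from \<open>Q j\<close> otherwise. The type and
  \<open>i\<close> do not change, and they stay independent of \<open>Q\<close>.\<close>

lemma robust_process:
  assumes j: "j \<in> I" "j \<notin> D" "D \<subseteq> I" and rob: "robust (insert j D) (process j (\<sigma> j) (K j - 1) A)"
  shows "robust D A"
proof -
  obtain \<tau> i where \<tau>i: "\<tau> \<in> T" "i \<in> I" and ex: "\<And>Q. \<forall>l\<in>I. admissible l (\<kappa> \<tau> l) (Q l) \<Longrightarrow>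
     \<exists>F\<in>process j (\<sigma> j) (K j - 1) A \<tau>. spread_member (insert j D) \<tau> i Q F"
    using rob unfolding robust_def by blast
  have "\<exists>F\<in>A \<tau>. spread_member D \<tau> i Q F"
    if adm: "\<forall>l\<in>I. admissible l (\<kappa> \<tau> l) (Q l)" for Q
  proof -
    obtain F where F: "F \<in> process j (\<sigma> j) (K j - 1) A \<tau>"
      "\<And>l. l \<in> insert j D \<Longrightarrow> l \<noteq> i \<Longrightarrow> F \<inter> B l = {}" "i \<in> insert j D \<Longrightarrow> F \<inter> B i \<noteq> {}"
      "\<And>l. l \<in> I - insert j D \<Longrightarrow> l \<noteq> i \<Longrightarrow> F \<inter> B l \<inter> Q l = {}"
      "\<And>l. l \<in> I - insert j D \<Longrightarrow> \<exists>t<n l. F \<inter> B l = \<sigma> l ` arc (n l) t (\<kappa> \<tau> l)"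
    proof -
      obtain F where "F \<in> process j (\<sigma> j) (K j - 1) A \<tau>" "spread_member (insert j D) \<tau> i Q F"
        using ex[OF adm] by blast
      then show ?thesis unfolding spread_member_def by (intro that[of F]) blast+
    qed
    define Y where "Y = F - B j"
    note pc = process_cases[OF j(1) F(1), folded Y_def]
    define h where "h = hits j (\<sigma> j) A \<tau> Y"
    have "\<exists>t\<in>h. j \<noteq> i \<longrightarrow> \<sigma> j ` arc (n j) t (\<kappa> \<tau> j) \<inter> Q j = {}"
    proof (cases "j = i")
      case True
      have "h \<noteq> {}" using pc(2) unfolding h_def by force
      then show ?thesis using True by blast
    next
      case False
      then have "F \<inter> B j = {}" using F(2) by auto
      then have "F \<noteq> insert (x j) Y" using x_in[OF j(1)] by auto
      \<comment> \<open>\<open>F\<close> has bit 0 in block \<open>j\<close>, so the strict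
        inequality with \<open>r = K j - 1\<close> gives exactly the number that admissibility
        undercuts.\<close>
      then have c: "\<kappa> \<tau> j + K j \<le> card h" using pc(3) K_bounds(1)[OF j(1)] unfolding h_def by linarith
      have "card {t. t < n j \<and> \<sigma> j ` arc (n j) t (\<kappa> \<tau> j) \<inter> Q j \<noteq> {}} < card h"
        using adm j(1) c unfolding admissible_def by fastforce
      then have "\<not> h \<subseteq> {t. t < n j \<and> \<sigma> j ` arc (n j) t (\<kappa> \<tau> j) \<inter> Q j \<noteq> {}}"
        using card_mono[of "{t. t < n j \<and> \<sigma> j ` arc (n j) t (\<kappa> \<tau> j) \<inter> Q j \<noteq> {}}" h] by auto
      then show ?thesis unfolding h_def hits_def by blast
    qed
    then obtain t where t: "t \<in> h" "j \<noteq> i \<Longrightarrow> \<sigma> j ` arc (n j) t (\<kappa> \<tau> j) \<inter> Q j = {}" by blast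
    define G where "G = \<sigma> j ` arc (n j) t (\<kappa> \<tau> j) \<union> Y"
    have tn: "t < n j" "G \<in> A \<tau>" using t(1) by (simp_all add: h_def hits_def G_def)
    have sub: "\<sigma> j ` arc (n j) t (\<kappa> \<tau> j) \<subseteq> B j"
      using bij_\<sigma>[OF j(1)] image_mono[OF arc_subset[OF n_pos[OF j(1)]], of "\<sigma> j"] by (simp add: bij_betw_def)
    have Gj: "G \<inter> B j = \<sigma> j ` arc (n j) t (\<kappa> \<tau> j)" using sub unfolding G_def Y_def by blast
    have Gl: "G \<inter> B l = F \<inter> B l" if "l \<in> I" "l \<noteq> j" for l
      using disjoint_blocks[OF that(1) j(1) that(2)] sub unfolding G_def Y_def by blast
    show ?thesis unfolding spread_member_def
    proof (intro bexI[of _ G] conjI ballI impI)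
      show "G \<in> A \<tau>" by (rule tn)
      fix l assume "l \<in> D" "l \<noteq> i"
      then show "G \<inter> B l = {}" using F(2)[of l] Gl[of l] j by auto
    next
      assume "i \<in> D"
      then show "G \<inter> B i \<noteq> {}" using F(3) Gl[OF \<tau>i(2)] j by auto
    next
      fix l assume "l \<in> I - D" "l \<noteq> i"
      then show "G \<inter> B l \<inter> Q l = {}" using F(4)[of l] Gl[of l] Gj t(2) by (cases "l = j") auto
    next
      fix l assume "l \<in> I - D"
      then show "\<exists>t<n l. G \<inter> B l = \<sigma> l ` arc (n l) t (\<kappa> \<tau> l)"
        using F(5)[of l] Gl[of l] Gj tn by (cases "l = j") auto
    qed
  qed
  then show ?thesis unfolding robust_def using \<tau>i by blast
qed

lemma W_less_not_robust:
  assumes A: "valid {} A" "cross_meeting A" "\<not> robust {} A"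
    and M: "\<And>i. i \<in> I \<Longrightarrow> star_weight i \<le> M" "0 < M"
  shows "W {} A < M"
proof (rule W_less[where ?r0.0 = "\<lambda>i. K i - 1" and P = "\<lambda>D A. \<not> robust D A", OF A(1,2) _ A(3) M])
  show "K i - 1 < K i" if "i \<in> I" for i using K_bounds(1)[OF that] by simp
  show "\<not> robust (insert i D) (process i (\<sigma> i) (K i - 1) A)"
    if "D \<subseteq> I" "\<not> robust D A" "i \<in> I - D" for D A i
    using that robust_process[of i D A] by blast
  show "{x i} \<notin> A \<tau>" if "\<not> robust I A" "\<tau> \<in> T" "i \<in> I" for A \<tau> i
    using that robust_final by blast
qed auto

end

section \<open>Shifting maximum intersecting families and undoing the shift of a star\<close>

context quota
begin

lemma b_le: "i \<in> I \<Longrightarrow> 3 * p * b i \<le> card (B i)"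
  using large by (simp add: b_def)

lemma b3_le: "i \<in> I \<Longrightarrow> 3 * b i \<le> card (B i)"
proof -
  assume i: "i \<in> I"
  have "1 * (3 * b i) \<le> p * (3 * b i)" using p by (rule mult_le_mono1)
  moreover have "p * (3 * b i) \<le> card (B i)" using b_le[OF i] by (simp only: mult_ac)
  ultimately show ?thesis by linarith
qed

lemma member_by_type:
  assumes "F \<subseteq> X" "G \<in> \<G>" "\<And>j. j \<in> I \<Longrightarrow> card (F \<inter> B j) = card (G \<inter> B j)"
  shows "F \<in> \<G>"
proof -
  have "card F = card G"
    using assms card_eq_sum_blocks[of F] card_eq_sum_blocks[of G] by (simp add: \<G>_iff)
  then show ?thesis using assms unfolding \<G>_iff by simp
qed

lemma shift_in_\<G>:
  assumes i: "i \<in> I" "u \<in> B i" "v \<in> B i" and F: "F \<in> \<G>" "v \<in> F" "u \<notin> F"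
  shows "insert u (F - {v}) \<in> \<G>"
proof (rule member_by_type[OF _ F(1)])
  show "insert u (F - {v}) \<subseteq> X" using F i block_subset by (auto simp: \<G>_iff)
  fix j assume j: "j \<in> I"
  show "card (insert u (F - {v}) \<inter> B j) = card (F \<inter> B j)"
  proof (cases "j = i")
    case True
    have "insert u (F - {v}) \<inter> B i = insert u (F \<inter> B i - {v})" using i by auto
    moreover have "finite (F \<inter> B i)" using finite_B i by auto
    then have "Suc (card (F \<inter> B i - {v})) = card (F \<inter> B i)" using i F by (intro card_Suc_Diff1) auto
    ultimately show ?thesis using True F finite_B[OF i(1)] by simp
  next
    case False
    then have "insert u (F - {v}) \<inter> B j = F \<inter> B j" using i blocks_disjoint[OF j i(1)] by auto
    then show ?thesis by simp
  qed
qed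

lemma star_intersecting: "intersecting {F \<in> \<G>. w \<in> F}"
  by (auto simp: intersecting_def)

lemma maximum_star:
  assumes A: "maximum_intersecting \<G> A" and w: "\<And>F. F \<in> A \<Longrightarrow> w \<in> F"
  shows "A = {F \<in> \<G>. w \<in> F}"
proof (rule card_seteq)
  show "finite {F \<in> \<G>. w \<in> F}" using finite_\<G> by auto
  show "A \<subseteq> {F \<in> \<G>. w \<in> F}" using A w by (auto simp: maximum_intersecting_def)
  show "card {F \<in> \<G>. w \<in> F} \<le> card A"
    using A star_intersecting unfolding maximum_intersecting_def by auto
qed

text \<open>The classical compression. A set stays put when its image is already a member, which
  makes the map injective on \<open>A\<close>.\<close>

definition shift :: "'a \<Rightarrow> 'a \<Rightarrow> 'a set set \<Rightarrow> 'a set \<Rightarrow> 'a set" where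
  "shift u v A F = (if v \<in> F \<and> u \<notin> F \<and> insert u (F - {v}) \<notin> A then insert u (F - {v}) else F)"

lemma shift_inj: "u \<noteq> v \<Longrightarrow> inj_on (shift u v A) A"
proof (rule inj_onI)
  fix F H assume uv: "u \<noteq> v" and h: "F \<in> A" "H \<in> A" "shift u v A F = shift u v A H"
  let ?m = "\<lambda>F. v \<in> F \<and> u \<notin> F \<and> insert u (F - {v}) \<notin> A"
  have undo: "F = insert v (insert u (F - {v}) - {u})" if "?m F" for F using that by auto
  consider "?m F" "?m H" | "?m F" "\<not> ?m H" | "\<not> ?m F" "?m H" | "\<not> ?m F" "\<not> ?m H" by blast
  then show "F = H"
  proof cases
    case 1
    then have "insert u (F - {v}) = insert u (H - {v})" using h by (simp add: shift_def)
    then show ?thesis using undo[of F] undo[of H] 1 by metis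
  next
    case 2 then show ?thesis using h by (simp add: shift_def) metis
  next
    case 3 then show ?thesis using h by (simp add: shift_def) metis
  next
    case 4 then show ?thesis using h by (simp add: shift_def) metis
  qed
qed

lemma shift_maximum:
  assumes A: "maximum_intersecting \<G> A" and i: "i \<in> I" "u \<in> B i" "v \<in> B i" "u \<noteq> v"
  shows "maximum_intersecting \<G> (shift u v A ` A)"
  unfolding maximum_intersecting_def
proof (intro conjI)
  have A\<G>: "A \<subseteq> \<G>" and int: "intersecting A" using A by (auto simp: maximum_intersecting_def)
  show "shift u v A ` A \<subseteq> \<G>" using A\<G> shift_in_\<G>[OF i(1-3)] by (auto simp: shift_def)
  show "\<forall>\<H>. \<H> \<subseteq> \<G> \<and> intersecting \<H> \<longrightarrow> card \<H> \<le> card (shift u v A ` A)"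
    using A card_image[OF shift_inj[OF i(4)]] by (simp add: maximum_intersecting_def)
  let ?m = "\<lambda>F. v \<in> F \<and> u \<notin> F \<and> insert u (F - {v}) \<notin> A"
  have meet: "F \<inter> H \<noteq> {}" if "F \<in> A" "H \<in> A" for F H using int that by (auto simp: intersecting_def)
  \<comment> \<open>The mixed case. If moving \<open>F\<close> made it disjoint from the unmoved
    \<open>H\<close>, they would have met only in \<open>v\<close>; then \<open>H\<close> stayed
    only because its own exchange is in \<open>A\<close>, and that exchange misses
    \<open>F\<close>.\<close>
  have one: "insert u (F - {v}) \<inter> H \<noteq> {}" if F: "F \<in> A" "?m F" and H: "H \<in> A" "\<not> ?m H" for F H
  proof
    assume e: "insert u (F - {v}) \<inter> H = {}"
    then have "u \<notin> H" "F \<inter> H \<subseteq> {v}" by auto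
    moreover have "v \<in> H" using meet[OF F(1) H(1)] calculation by auto
    ultimately have "insert u (H - {v}) \<in> A" using H by blast
    from meet[OF F(1) this] show False using e F by auto
  qed
  show "intersecting (shift u v A ` A)"
    unfolding intersecting_def
  proof (intro ballI)
    fix F' H' assume "F' \<in> shift u v A ` A" "H' \<in> shift u v A ` A"
    then obtain F H where FH: "F \<in> A" "H \<in> A" "F' = shift u v A F" "H' = shift u v A H" by blast
    consider "?m F" "?m H" | "?m F" "\<not> ?m H" | "\<not> ?m F" "?m H" | "\<not> ?m F" "\<not> ?m H" by blast
    then show "F' \<inter> H' \<noteq> {}"
    proof cases
      case 1
      then have "u \<in> F' \<inter> H'" using FH by (simp add: shift_def)
      then show ?thesis by blast
    next
      case 2
      then have "F' = insert u (F - {v})" "H' = H" using FH(3,4) unfolding shift_def by (simp_all only: if_True if_False simp_thms)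
      then show ?thesis using one[OF FH(1) 2(1) FH(2) 2(2)] by simp
    next
      case 3
      then have "H' = insert u (H - {v})" "F' = F" using FH(3,4) unfolding shift_def by (simp_all only: if_True if_False simp_thms)
      then show ?thesis using one[OF FH(2) 3(2) FH(1) 3(1)] by (simp add: Int_commute)
    next
      case 4
      then have "H' = H" "F' = F" using FH(3,4) unfolding shift_def by (simp_all only: if_True if_False simp_thms)
      then show ?thesis using meet[OF FH(1,2)] by simp
    qed
  qed
qed

text \<open>If \<open>A\<close> is not a star, the centre must be \<open>u\<close>, and
  \<open>A\<close> has members \<open>F\<close> without \<open>u\<close> and \<open>H\<close>
  without \<open>v\<close>. A set \<open>insert u E\<close> of the type of \<open>H\<close> with
  \<open>E\<close> outside both lies in the shifted star; it comes from \<open>insert u E\<close>,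
  which misses \<open>F\<close>, or from \<open>insert v E\<close>, which misses
  \<open>H\<close>.\<close>

lemma star_of_shift_star:
  assumes A: "maximum_intersecting \<G> A" and i: "i \<in> I" "u \<in> B i" "v \<in> B i" "u \<noteq> v"
    and z: "z \<in> X" and star: "shift u v A ` A = {F \<in> \<G>. z \<in> F}"
  shows "full_1_star X \<G> A"
proof (rule ccontr)
  assume no: "\<not> full_1_star X \<G> A"
  have A\<G>: "A \<subseteq> \<G>" and int: "intersecting A" using A by (auto simp: maximum_intersecting_def)
  have avoid: "\<exists>F\<in>A. w \<notin> F" if "w \<in> X" for w
    using no maximum_star[OF A, of w] that unfolding full_1_star_def by blast
  have sh: "z \<in> shift u v A F" if "F \<in> A" for F using star that by blast
  \<comment> \<open>Some member of \<open>A\<close> avoids \<open>z\<close>, and \<open>u\<close> is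
    the only element that the shift can add to it.\<close>
  have "z = u"
  proof -
    obtain F where "F \<in> A" "z \<notin> F" using avoid[OF z] by blast
    then show ?thesis using sh[of F] by (auto simp: shift_def split: if_splits)
  qed
  have X: "u \<in> X" "v \<in> X" using i block_subset by auto
  obtain F where F: "F \<in> A" "u \<notin> F" using avoid[OF X(1)] by blast
  then have vF: "v \<in> F" using sh[OF F(1)] \<open>z = u\<close> by (auto simp: shift_def split: if_splits)
  obtain H where H: "H \<in> A" "v \<notin> H" using avoid[OF X(2)] by blast
  then have uH: "u \<in> H" using sh[OF H(1)] \<open>z = u\<close> by (auto simp: shift_def)
  have mem: "F \<in> \<G>" "H \<in> \<G>" using F H A\<G> by auto
  \<comment> \<open>In each block \<open>F\<close> and \<open>H\<close> use at most
    \<open>2 * b j\<close> elements, so \<open>3 * b j \<le> card (B j)\<close> leaves enough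
    room.\<close>
  have "\<exists>S. S \<subseteq> B j - (F \<union> H) \<and> card S = card ((H - {u}) \<inter> B j)" if j: "j \<in> I" for j
  proof -
    have "card ((F \<union> H) \<inter> B j) \<le> card (F \<inter> B j) + card (H \<inter> B j)"
      by (simp add: Int_Un_distrib2 card_Un_le)
    then have "card ((F \<union> H) \<inter> B j) \<le> 2 * b j"
      using card_block_le[OF mem(1) j] card_block_le[OF mem(2) j] by simp
    moreover have "card ((H - {u}) \<inter> B j) \<le> b j"
      using card_block_le[OF mem(2) j] card_mono[of "H \<inter> B j" "(H - {u}) \<inter> B j"] finite_B[OF j] by fastforce
    moreover have "card (B j - (F \<union> H)) = card (B j) - card ((F \<union> H) \<inter> B j)"
      using finite_B[OF j] by (subst card_Diff_subset_Int) (auto simp: Int_commute)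
    ultimately have "card ((H - {u}) \<inter> B j) \<le> card (B j - (F \<union> H))" using b3_le[OF j] by linarith
    then show ?thesis using obtain_subset_with_card_n by metis
  qed
  then obtain S where S: "\<And>j. j \<in> I \<Longrightarrow> S j \<subseteq> B j - (F \<union> H) \<and> card (S j) = card ((H - {u}) \<inter> B j)"
    by metis
  define E where "E = (\<Union>j\<in>I. S j)"
  have Ej: "E \<inter> B j = S j" if "j \<in> I" for j
  proof
    show "E \<inter> B j \<subseteq> S j"
    proof
      fix y assume y: "y \<in> E \<inter> B j"
      then obtain l where l: "l \<in> I" "y \<in> S l" by (auto simp: E_def)
      then have "l = j" using S[OF l(1)] y blocks_disjoint[OF l(1) that] by auto
      then show "y \<in> S j" using l by simp
    qed
    show "S j \<subseteq> E \<inter> B j" using S[OF that] that by (auto simp: E_def)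
  qed
  have dis: "E \<inter> (F \<union> H) = {}" using S by (fastforce simp: E_def)
  have EX: "E \<subseteq> X" using S by (fastforce simp: E_def X_def)
  have "insert u E \<in> \<G>"
  proof (rule member_by_type[OF _ mem(2)])
    show "insert u E \<subseteq> X" using EX X by auto
    fix j assume j: "j \<in> I"
    have finj: "finite (H \<inter> B j)" "finite (S j)" using finite_B[OF j] S[OF j] finite_subset by blast+
    show "card (insert u E \<inter> B j) = card (H \<inter> B j)"
    proof (cases "j = i")
      case True
      have "insert u E \<inter> B j = insert u (S j)" using Ej[OF j] i True by auto
      moreover have "u \<notin> S j" using S[OF j] uH by auto
      moreover have "Suc (card (H \<inter> B j - {u})) = card (H \<inter> B j)"
        using finj uH i True by (intro card_Suc_Diff1) auto
      moreover have "(H - {u}) \<inter> B j = H \<inter> B j - {u}" by auto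
      ultimately show ?thesis using S[OF j] finj by simp
    next
      case False
      then have "u \<notin> B j" using i blocks_disjoint[OF j i(1)] by auto
      then have "insert u E \<inter> B j = S j" "(H - {u}) \<inter> B j = H \<inter> B j" using Ej[OF j] by auto
      then show ?thesis using S[OF j] by simp
    qed
  qed
  then have "insert u E \<in> shift u v A ` A" using star \<open>z = u\<close> by auto
  then obtain G where G: "G \<in> A" "insert u E = shift u v A G" by blast
  have uv: "u \<notin> E" "v \<notin> E" using dis uH vF by auto
  have "G = insert u E \<or> G = insert v E"
  proof (cases "v \<in> G \<and> u \<notin> G \<and> insert u (G - {v}) \<notin> A")
    case True
    then have "insert u E = insert u (G - {v})" using G by (simp add: shift_def)
    then have "E = G - {v}" using uv True by (metis Diff_iff insert_ident)
    then show ?thesis using True by auto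
  next
    case False
    then show ?thesis using G by (metis shift_def)
  qed
  then show False
  proof
    assume "G = insert u E"
    then have "G \<inter> F = {}" using dis F by auto
    then show False using int G F by (auto simp: intersecting_def)
  next
    assume "G = insert v E"
    then have "G \<inter> H = {}" using dis H by auto
    then show False using int G H by (auto simp: intersecting_def)
  qed
qed

end

section \<open>Comparison with the stars\<close>

context quota
begin

lemma blocks_axioms:
  assumes "\<And>i. i \<in> I \<Longrightarrow> bij_betw (\<sigma> i) {..<card (B i)} (B i)"
  shows "blocks I B first T (\<lambda>\<tau>. \<tau>) b \<sigma>"
proof
  show "\<tau> i \<le> b i" if "\<tau> \<in> T" "i \<in> I" for \<tau> i
    using that card_block_le by (auto simp: type_def)
qed (use finite_B disjoint_B first finite_\<G> b_le assms in auto)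

lemma prod_choose_le_card_type:
  assumes "\<tau> \<in> T"
  shows "(\<Prod>j\<in>I. card (B j) choose \<tau> j) \<le> card {F \<in> \<G>. type F = \<tau>}"
proof -
  obtain G where G: "G \<in> \<G>" "\<tau> = type G" using assms by auto
  define P where "P = (\<Pi>\<^sub>E j\<in>I. {S. S \<subseteq> B j \<and> card S = \<tau> j})"
  have un: "(\<Union>j\<in>I. f j) \<inter> B i = f i" if f: "f \<in> P" and i: "i \<in> I" for f i
  proof -
    have sub: "f j \<subseteq> B j" if "j \<in> I" for j using f that by (auto simp: P_def PiE_iff)
    have "f j \<inter> B i = {}" if "j \<in> I" "j \<noteq> i" for j
      using sub[OF that(1)] blocks_disjoint[OF that(1) i that(2)] by blast
    then show ?thesis using sub[OF i] i by blast
  qed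
  have "card P = (\<Prod>j\<in>I. card (B j) choose \<tau> j)"
    unfolding P_def using finite_B by (subst card_PiE) (auto simp: n_subsets)
  moreover have "card P \<le> card {F \<in> \<G>. type F = \<tau>}"
  proof (rule card_inj_on_le[where f = "\<lambda>f. \<Union>j\<in>I. f j"])
    show "inj_on (\<lambda>f. \<Union>j\<in>I. f j) P"
    proof (rule inj_onI)
      fix f g assume fg: "f \<in> P" "g \<in> P" "(\<Union>j\<in>I. f j) = (\<Union>j\<in>I. g j)"
      show "f = g"
      proof (rule PiE_ext[OF fg(1,2)[unfolded P_def]])
        fix i assume i: "i \<in> I"
        show "f i = g i" using un[OF fg(1) i] un[OF fg(2) i] fg(3) by simp
      qed
    qed
    show "(\<lambda>f. \<Union>j\<in>I. f j) ` P \<subseteq> {F \<in> \<G>. type F = \<tau>}"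
    proof
      fix F assume "F \<in> (\<lambda>f. \<Union>j\<in>I. f j) ` P"
      then obtain f where f: "f \<in> P" "F = (\<Union>j\<in>I. f j)" by blast
      have c: "card (F \<inter> B j) = card (G \<inter> B j)" if "j \<in> I" for j
        using un[OF f(1) that] f that G by (auto simp: P_def PiE_iff type_def)
      have "F \<subseteq> X" using f by (fastforce simp: P_def PiE_iff X_def)
      then have "F \<in> \<G>" using member_by_type[OF _ G(1) c] by blast
      moreover have "type F = \<tau>" using c G by (auto simp: type_def fun_eq_iff)
      ultimately show "F \<in> {F \<in> \<G>. type F = \<tau>}" by simp
    qed
    show "finite {F \<in> \<G>. type F = \<tau>}" using finite_\<G> by auto
  qed
  ultimately show ?thesis by simp
qed

text \<open>The left side is at most the average size of the stars centred in block
  \<open>i\<close>, by counting pairs of a member and one of its elements there. Each star is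
  intersecting, so \<open>card A\<close> can serve as the bound \<open>M\<close>; a strict bound on
  \<open>W\<close> then contradicts that \<open>W\<close> of the untouched family is
  \<open>card A\<close>.\<close>

lemma star_weight_le:
  assumes A: "maximum_intersecting \<G> A" and i: "i \<in> I"
  shows "(\<Sum>\<tau>\<in>T. (\<Prod>j\<in>I. real (card (B j) choose \<tau> j)) * (\<tau> i / card (B i))) \<le> card A"
proof -
  have pos: "0 < real (card (B i))" using card_B_pos[OF i] by simp
  have "(\<Sum>\<tau>\<in>T. (\<Prod>j\<in>I. card (B j) choose \<tau> j) * \<tau> i) \<le> (\<Sum>\<tau>\<in>T. card {F \<in> \<G>. type F = \<tau>} * \<tau> i)"
    using prod_choose_le_card_type by (intro sum_mono mult_right_mono) auto
  also have "\<dots> = (\<Sum>\<tau>\<in>T. \<Sum>F | F \<in> \<G> \<and> type F = \<tau>. card (F \<inter> B i))"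
  proof (rule sum.cong[OF refl])
    fix \<tau>
    have "(\<Sum>F | F \<in> \<G> \<and> type F = \<tau>. card (F \<inter> B i)) = (\<Sum>F | F \<in> \<G> \<and> type F = \<tau>. \<tau> i)"
      using i by (intro sum.cong refl) (auto simp: type_def)
    then show "card {F \<in> \<G>. type F = \<tau>} * \<tau> i = (\<Sum>F | F \<in> \<G> \<and> type F = \<tau>. card (F \<inter> B i))"
      by simp
  qed
  also have "\<dots> = (\<Sum>F\<in>\<G>. card (F \<inter> B i))"
    using finite_\<G> by (intro sum.group) auto
  also have "\<dots> = (\<Sum>F\<in>\<G>. \<Sum>y\<in>B i. of_bool (y \<in> F))"
    using finite_B[OF i] by (intro sum.cong refl) (simp add: of_bool_def sum.If_cases Int_commute)
  also have "\<dots> = (\<Sum>y\<in>B i. card {F \<in> \<G>. y \<in> F})"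
    using finite_\<G> by (subst sum.swap) (simp add: of_bool_def sum.If_cases Int_def)
  also have "\<dots> \<le> (\<Sum>y\<in>B i. card A)"
    using A star_intersecting unfolding maximum_intersecting_def by (intro sum_mono) auto
  finally have "(\<Sum>\<tau>\<in>T. (\<Prod>j\<in>I. card (B j) choose \<tau> j) * \<tau> i) \<le> card (B i) * card A" by simp
  then have "real (\<Sum>\<tau>\<in>T. (\<Prod>j\<in>I. card (B j) choose \<tau> j) * \<tau> i) \<le> real (card (B i) * card A)"
    by (rule of_nat_mono)
  then have "(\<Sum>\<tau>\<in>T. (\<Prod>j\<in>I. real (card (B j) choose \<tau> j)) * \<tau> i) / card (B i) \<le> card A"
    using pos by (simp add: field_simps)
  then show ?thesis by (simp add: sum_divide_distrib)
qed

definition by_type :: "'a set set \<Rightarrow> (nat \<Rightarrow> nat) \<Rightarrow> 'a set set" where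
  "by_type A \<tau> = {F \<in> A. type F = \<tau>}"

lemma by_type_facts:
  assumes "blocks I B first T (\<lambda>\<tau>. \<tau>) b \<sigma>" and A: "A \<subseteq> \<G>" "intersecting A"
  shows "blocks.valid I B first T (\<lambda>\<tau>. \<tau>) {} (by_type A)"
    and "blocks.cross_meeting T (by_type A)"
    and "blocks.W B first T (\<lambda>\<tau>. \<tau>) {} (by_type A) = card A"
proof -
  interpret bl: blocks I B first T "\<lambda>\<tau>. \<tau>" b \<sigma> by fact
  have XX: "bl.X = X" unfolding bl.X_def X_def ..
  show "bl.valid {} (by_type A)"
    unfolding bl.valid_def XX
  proof (intro ballI conjI)
    fix \<tau> F assume F: "F \<in> by_type A \<tau>"
    then have "F \<in> \<G>" using A by (auto simp: by_type_def)
    then show "F \<subseteq> X" unfolding \<G>_iff by blast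
    show "card (F \<inter> B i) = \<tau> i" if "i \<in> I - {}" for i
      using F that unfolding by_type_def type_def by auto
  qed auto
  show "bl.cross_meeting (by_type A)"
    using A unfolding bl.cross_meeting_def by_type_def intersecting_def by auto
  have fin: "finite A" using A finite_\<G> finite_subset by blast
  have "bl.W {} (by_type A) = real (\<Sum>\<tau>\<in>T. card {F \<in> A. type F = \<tau>})"
    unfolding bl.W_def bl.weight_def by_type_def by simp
  also have "(\<Sum>\<tau>\<in>T. card {F \<in> A. type F = \<tau>}) = (\<Sum>\<tau>\<in>T. \<Sum>F | F \<in> A \<and> type F = \<tau>. 1)" by simp
  also have "\<dots> = (\<Sum>F\<in>A. 1)" using fin A finite_\<G> by (intro sum.group) auto
  finally show "bl.W {} (by_type A) = card A" by simp
qed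

section \<open>Shifted maximum families are stars\<close>

lemma layout_bij:
  assumes i: "i \<in> I" and \<pi>: "bij_betw \<pi> {..<card (B i)} {..<card (B i)}"
  shows "bij_betw (inv_into (B i) rk \<circ> \<pi>) {..<card (B i)} (B i)"
    and "t < card (B i) \<Longrightarrow> rk ((inv_into (B i) rk \<circ> \<pi>) t) = \<pi> t"
proof -
  show "bij_betw (inv_into (B i) rk \<circ> \<pi>) {..<card (B i)} (B i)"
    using \<pi> bij_betw_inv_into[OF rk[OF i]] by (rule bij_betw_trans)
  show "rk ((inv_into (B i) rk \<circ> \<pi>) t) = \<pi> t" if "t < card (B i)"
    using that \<pi> rk[OF i] by (auto simp: bij_betw_def intro!: f_inv_into_f)
qed

lemma stable_shift_first:
  assumes "stable A" "F \<in> A" "i \<in> I" "v \<in> F" "v \<in> B i" "first i \<notin> F"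
  shows "insert (first i) (F - {v}) \<in> A"
proof -
  have "rk (first i) < rk v" using first[OF assms(3)] rk_inj[OF assms(3), of v "first i"] assms by auto
  then show ?thesis using assms first[OF assms(3)] unfolding stable_def by blast
qed

text \<open>Katona's argument made strict. A member avoiding \<open>first 1\<close> can be
  compressed onto the arc of positions \<open>k\<close> to \<open>2 * k - 1\<close>, and
  intersecting it confines the arcs in \<open>A\<close> to at most \<open>k\<close>. If there were
  exactly \<open>k\<close>, exchanging one element for \<open>first 1\<close> would produce two
  disjoint members.\<close>

lemma stable_maximum_single_block:
  assumes p1: "p = 1" and A: "maximum_intersecting \<G> A" "stable A" "A \<noteq> {}"
  shows "\<forall>F\<in>A. first 1 \<in> F"
proof (rule ccontr)
  assume "\<not> ?thesis"
  then obtain F0 where F0: "F0 \<in> A" "first 1 \<notin> F0" by blast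
  have A\<G>: "A \<subseteq> \<G>" and int: "intersecting A" using A by (auto simp: maximum_intersecting_def)
  have I1: "I = {1}" and i: "1 \<in> I" using p1 by auto
  define n where "n = card (B 1)"
  have b1: "b 1 = k" using sum_a unfolding b_def I1 by simp
  have n3: "3 * k \<le> n" using b3_le[OF i] b1 by (simp add: n_def)
  have card_k: "card (F \<inter> B 1) = k" "F \<subseteq> B 1" if "F \<in> \<G>" for F
    using that card_eq_sum_blocks[of F] unfolding \<G>_iff X_def I1 by auto
  \<comment> \<open>Ranks 1 to \<open>k\<close> form one arc starting at \<open>k\<close>. Rank 0
    sits at position 0, outside all arcs starting at 1 to \<open>2 * k - 1\<close>, because these
    end before \<open>3 * k \<le> n\<close>.\<close>
  define g where "g r = (if r = 0 then 0 else k - 1 + r)" for r :: nat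
  have "{..k} \<subseteq> {..<n}" "g ` {..k} \<subseteq> {..<n}" using n3 k by (auto simp: g_def)
  moreover have "inj_on g {..k}" using k by (auto simp: g_def inj_on_def split: if_splits)
  ultimately obtain \<pi> where \<pi>: "bij_betw \<pi> {..<n} {..<n}" "\<And>r. r \<in> {..k} \<Longrightarrow> \<pi> (g r) = r"
    using extend_placement by metis
  define s where "s = inv_into (B 1) rk \<circ> \<pi>"
  have s: "bij_betw s {..<n} (B 1)" and rks: "\<And>t. t < n \<Longrightarrow> rk (s t) = \<pi> t"
    using layout_bij[OF i, of \<pi>] \<pi>(1) unfolding s_def n_def by auto
  have s_in: "s t \<in> B 1" if "t < n" for t using s that by (auto simp: bij_betw_def)
  have s_inj: "s t = s u \<longleftrightarrow> t = u" if "t < n" "u < n" for t u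
    using s that by (auto simp: bij_betw_def inj_on_def)
  have s0: "s 0 = first 1"
  proof -
    have "rk (s 0) = 0" using rks[of 0] \<pi>(2)[of 0] n3 k by (simp add: g_def)
    then show ?thesis using first[OF i] rk_inj[OF i, of "s 0" "first 1"] s_in[of 0] n3 k by auto
  qed
  have rkpos: "s t \<noteq> first 1" if "1 \<le> t" "t < n" for t
    unfolding s0[symmetric] using s_inj[of t 0] that by auto
  obtain G where G: "G \<in> A" "\<And>y. y \<in> G \<inter> B 1 \<Longrightarrow> 1 \<le> rk y \<and> rk y \<le> card (G \<inter> B 1)"
    using stable_compressed_member[OF A(2) A\<G> i F0] by metis
  have Gs: "G \<subseteq> s ` {k..<2 * k}"
  proof
    fix y assume y: "y \<in> G"
    have GG: "G \<in> \<G>" using G A\<G> by auto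
    have yB: "y \<in> B 1" using card_k(2)[OF GG] y by auto
    have r: "1 \<le> rk y" "rk y \<le> k" using G(2)[of y] y yB card_k(1)[OF GG] by auto
    have lt: "k - 1 + rk y < n" using r n3 k by linarith
    have "rk (s (k - 1 + rk y)) = rk y" using rks[OF lt] \<pi>(2)[of "rk y"] r by (simp add: g_def)
    then have "s (k - 1 + rk y) = y" using rk_inj[OF i s_in[OF lt] yB] by simp
    moreover have "k - 1 + rk y \<in> {k..<2 * k}" using r k by auto
    ultimately show "y \<in> s ` {k..<2 * k}" by (metis image_eqI)
  qed
  have meet: "s ` U \<inter> s ` V = {} \<longleftrightarrow> U \<inter> V = {}" if "U \<subseteq> {..<n}" "V \<subseteq> {..<n}" for U V
    using inj_on_image_Int[of s "{..<n}" U V] s that by (auto simp: bij_betw_def)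
  have int2: "F \<inter> H \<noteq> {}" if "F \<in> A" "H \<in> A" for F H using int that by (auto simp: intersecting_def)
  have arc_eq: "arc n t k = {t..<t + k}" if "t + k \<le> n" for t
  proof -
    have "arc n t k = (\<lambda>j. t + j) ` {..<k}" unfolding arc_def using that by (intro image_cong) auto
    also have "\<dots> = {t..<t + k}" by (simp add: lessThan_atLeast0 add.commute)
    finally show ?thesis .
  qed
  define P where "P = {t. t < n \<and> s ` arc n t k \<in> A}"
  have Pint: "t \<in> P \<Longrightarrow> t + k \<le> n \<Longrightarrow> s ` {t..<t + k} \<in> A" for t using arc_eq by (auto simp: P_def)
  have n0: "0 < n" using n3 k by auto
  \<comment> \<open>Every arc in \<open>A\<close> must meet the positions \<open>k\<close> to
    \<open>2 * k - 1\<close> of \<open>G\<close>.\<close>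
  have Prange: "1 \<le> t \<and> t < 2 * k" if t: "t \<in> P" for t
  proof (rule ccontr)
    assume neg: "\<not> ?thesis"
    have "s ` arc n t k \<inter> s ` {k..<2 * k} \<noteq> {}" using int2[OF _ G(1)] t Gs by (auto simp: P_def)
    then have "arc n t k \<inter> {k..<2 * k} \<noteq> {}"
      using meet[OF arc_subset[OF n0], of "{k..<2 * k}"] n3 by (simp add: subset_iff)
    then obtain j where j: "j < k" "k \<le> (t + j) mod n" "(t + j) mod n < 2 * k" by (auto simp: arc_def)
    have tn: "t < n" using t by (simp add: P_def)
    show False
    proof (cases "t + j < n")
      case True
      then show ?thesis using j neg by auto
    next
      case False
      then have "(t + j) mod n = (t + j - n) mod n" by (intro le_mod_geq) simp
      also have "\<dots> = t + j - n" using tn j n3 by (intro mod_less) linarith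
      finally show ?thesis using j tn by linarith
    qed
  qed
  have disj: False if j: "1 \<le> j" "j < k" "j \<in> P" "j + k \<in> P" for j
  proof -
    have "s ` {j..<j + k} \<inter> s ` {j + k..<j + k + k} \<noteq> {}"
      using int2[OF Pint[OF j(3)] Pint[OF j(4)]] j n3 by auto
    moreover have "{j..<j + k} \<subseteq> {..<n}" "{j + k..<j + k + k} \<subseteq> {..<n}" using j n3 by auto
    ultimately show False using meet[of "{j..<j + k}" "{j + k..<j + k + k}"] by auto
  qed
  text \<open>If an arc in \<open>A\<close> meets another member only in \<open>s v\<close>, this exchange destroys the
    intersection.\<close>
  have replace: "insert (first 1) (s ` {t..<t + k} - {s v}) \<in> A"
    if "t \<in> P" "1 \<le> t" "t \<le> v" "v < t + k" "t + k \<le> n" for t v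
  proof (rule stable_shift_first[OF A(2) Pint[OF that(1,5)] i])
    show "s v \<in> s ` {t..<t + k}" using that by auto
    show "s v \<in> B 1" using s_in that by auto
    show "first 1 \<notin> s ` {t..<t + k}"
    proof
      assume "first 1 \<in> s ` {t..<t + k}"
      then obtain u where u: "u \<in> {t..<t + k}" "first 1 = s u" by blast
      then show False using rkpos[of u] that by auto
    qed
  qed
  have remove: "s ` U - {s v} = s ` (U - {v})" if "U \<subseteq> {..<n}" "v < n" for U v
    using s_inj that by (auto simp: subset_iff)
  \<comment> \<open>The arc from 1 meets the positions of \<open>G\<close> only in position
    \<open>k\<close>; exchanging that element for \<open>first 1\<close> makes the two
    disjoint.\<close>
  have not1: "1 \<notin> P"
  proof
    assume "1 \<in> P"
    then have "insert (first 1) (s ` {1..<1 + k} - {s k}) \<in> A" using n3 k by (intro replace) auto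
    moreover have "insert (first 1) (s ` {1..<1 + k} - {s k}) = s ` (insert 0 ({1..<1 + k} - {k}))"
    proof -
      have r: "s ` {1..<1 + k} - {s k} = s ` ({1..<1 + k} - {k})" using n3 k by (intro remove) auto
      show ?thesis unfolding r image_insert s0 ..
    qed
    ultimately have "s ` (insert 0 ({1..<1 + k} - {k})) \<inter> s ` {k..<2 * k} \<noteq> {}"
      using int2[OF _ G(1)] Gs by (metis Int_mono equalityD1 subset_empty)
    moreover have "s ` (insert 0 ({1..<1 + k} - {k})) \<inter> s ` {k..<2 * k} = {} \<longleftrightarrow> insert 0 ({1..<1 + k} - {k}) \<inter> {k..<2 * k} = {}" using n3 k by (intro meet) auto
    moreover have "insert 0 ({1..<1 + k} - {k}) \<inter> {k..<2 * k} = {}" using n3 k by auto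
    ultimately show False by (simp only:)
  qed
  have "card P < k"
  proof (rule ccontr)
    assume "\<not> card P < k"
    then have kP: "k \<le> card P" by simp
    have finP: "finite P" by (simp add: P_def)
    \<comment> \<open>Equal residues would give starts \<open>j\<close> and \<open>j + k\<close>,
      whose arcs are disjoint.\<close>
    have "inj_on (\<lambda>t. t mod k) P"
    proof (rule inj_onI)
      have *: "t = u" if tu: "t \<in> P" "u \<in> P" "t mod k = u mod k" "t \<le> u" for t u
      proof (rule ccontr)
        assume "t \<noteq> u"
        have tr: "1 \<le> t" "u < 2 * k" using Prange tu by auto
        show False
        proof (cases "t < k")
          case True
          then have "u mod k = t" using tu by simp
          moreover have "k \<le> u" using True tu \<open>t \<noteq> u\<close> by (metis leI mod_less)
          then have "u mod k = u - k" using tr by (simp add: le_mod_geq)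
          ultimately have "u = t + k" using \<open>k \<le> u\<close> by simp
          then show False using disj[of t] tu tr True by simp
        next
          case False
          then have "t mod k = t - k" "u mod k = u - k" using tr tu by (simp_all add: le_mod_geq)
          then show False using tu \<open>t \<noteq> u\<close> False by simp
        qed
      qed
      fix t u assume "t \<in> P" "u \<in> P" "t mod k = u mod k"
      then show "t = u" using *[of t u] *[of u t] by (cases "t \<le> u") auto
    qed
    then have "card ((\<lambda>t. t mod k) ` P) = card P" by (rule card_image)
    moreover have "(\<lambda>t. t mod k) ` P \<subseteq> {..<k}" using k by auto
    ultimately have onto: "(\<lambda>t. t mod k) ` P = {..<k}" using kP by (intro card_seteq) auto
    have either: "j \<in> P \<or> j + k \<in> P" if j: "j < k" for j
    proof -
      have "j \<in> (\<lambda>t. t mod k) ` P" using onto j by auto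
      then obtain t where t: "t \<in> P" "j = t mod k" by blast
      then have "t = j \<or> t = j + k" using Prange[OF t(1)] by (cases "t < k") (auto simp: le_mod_geq)
      then show ?thesis using t by auto
    qed
    have "k \<in> P" using either[of 0] Prange[of 0] k by auto
    \<comment> \<open>If every residue occurs, then minimality of \<open>l\<close> puts
      \<open>l - 1 + k\<close> into \<open>P\<close>. The arcs from \<open>l\<close> and from
      \<open>l - 1 + k\<close> share one position only, and exchanging it for position 0 separates
      them.\<close>
    define l where "l = (LEAST t. t \<in> P)"
    have l: "l \<in> P" "l \<le> k" using LeastI[of "\<lambda>t. t \<in> P", OF \<open>k \<in> P\<close>] Least_le[of "\<lambda>t. t \<in> P", OF \<open>k \<in> P\<close>] by (auto simp: l_def)
    have "2 \<le> l" using Prange[OF l(1)] not1 l by (cases "l = 1") auto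
    then have "l - 1 \<notin> P" using not_less_Least[of "l - 1" "\<lambda>t. t \<in> P"] by (auto simp: l_def)
    then have Q: "l - 1 + k \<in> P" using either[of "l - 1"] l \<open>2 \<le> l\<close> by auto
    let ?v = "l - 1 + k"
    have bnd: "?v + k \<le> n" "?v < l + k" "l + k \<le> n" using l n3 \<open>2 \<le> l\<close> k by linarith+
    have "insert (first 1) (s ` {l..<l + k} - {s ?v}) \<in> A"
      using l \<open>2 \<le> l\<close> bnd k by (intro replace) linarith+
    moreover have "insert (first 1) (s ` {l..<l + k} - {s ?v}) = s ` (insert 0 ({l..<l + k} - {?v}))"
    proof -
      have r: "s ` {l..<l + k} - {s ?v} = s ` ({l..<l + k} - {?v})" using bnd by (intro remove) auto
      show ?thesis unfolding r image_insert s0 ..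
    qed
    ultimately have "s ` (insert 0 ({l..<l + k} - {?v})) \<inter> s ` {?v..<?v + k} \<noteq> {}"
      using int2[OF _ Pint[OF Q bnd(1)]] by metis
    moreover have "s ` (insert 0 ({l..<l + k} - {?v})) \<inter> s ` {?v..<?v + k} = {} \<longleftrightarrow> insert 0 ({l..<l + k} - {?v}) \<inter> {?v..<?v + k} = {}" using bnd \<open>2 \<le> l\<close> by (intro meet) auto
    moreover have "insert 0 ({l..<l + k} - {?v}) \<inter> {?v..<?v + k} = {}" using bnd \<open>2 \<le> l\<close> by auto
    ultimately show False by (simp only:)
  qed
  have bax: "blocks I B first T (\<lambda>\<tau>. \<tau>) b (\<lambda>_. s)"
  proof (rule blocks_axioms)
    fix i assume "i \<in> I"
    then have "i = 1" using p1 by auto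
    then show "bij_betw s {..<card (B i)} (B i)" using s by (simp add: n_def)
  qed
  interpret bl: blocks I B first T "\<lambda>\<tau>. \<tau>" b "\<lambda>_. s" by (rule bax)
  note bt = by_type_facts[OF bax A\<G> int]
  \<comment> \<open>At threshold 0 both values of the bit need at least \<open>k\<close> hits, so on
    the chosen cyclic order nothing survives, and in particular no singleton.\<close>
  have "bl.W {} (by_type A) < card A"
  proof (rule bl.W_less[where ?r0.0 = "\<lambda>_. 0" and
        P = "\<lambda>D A'. if D = {} then A' = by_type A else \<forall>\<tau>\<in>T. A' \<tau> = {}", OF bt(1,2)])
    show "bl.star_weight i \<le> real (card A)" if "i \<in> I" for i
      unfolding bl.star_weight_def using star_weight_le[OF A(1) that] by simp
    show "0 < real (card A)" using A(3) finite_subset[OF A\<G> finite_\<G>] by (simp add: card_gt_0_iff)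
    show "0 < card (B i) - b i" if "i \<in> I" for i using bl.K_bounds(1)[OF that] .
    show "{first i} \<notin> A' \<tau>"
      if "if I = {} then A' = by_type A else \<forall>\<tau>\<in>T. A' \<tau> = {}" "\<tau> \<in> T" for A' \<tau> i
      using that p by (auto split: if_splits)
    fix D A' i
    assume h: "if D = {} then A' = by_type A else \<forall>\<tau>\<in>T. A' \<tau> = {}" "i \<in> I - D" "D \<subseteq> I"
    then have D: "D = {}" "i = 1" unfolding I1 by auto
    then have A': "A' = by_type A" using h(1) by simp
    have "bl.process 1 s 0 (by_type A) \<tau> = {}" if \<tau>: "\<tau> \<in> T" for \<tau>
    proof -
      have \<tau>1: "\<tau> 1 = k" using \<tau> card_k(1) i by (auto simp: type_def)
      have small: "card (bl.hits 1 s (by_type A) \<tau> Y) < k" if "Y \<subseteq> bl.X - B 1" for Y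
      proof -
        have "Y = {}" using that unfolding bl.X_def by (auto simp: p1)
        then have "bl.hits 1 s (by_type A) \<tau> Y \<subseteq> P"
          unfolding bl.hits_def \<tau>1 by (auto simp: by_type_def P_def n_def)
        then have "card (bl.hits 1 s (by_type A) \<tau> Y) \<le> card P" by (intro card_mono) (auto simp: P_def)
        then show ?thesis using \<open>card P < k\<close> by simp
      qed
      have False if "F \<in> bl.process 1 s 0 (by_type A) \<tau>" for F
        using bl.process_cases(1,3)[OF i that] small[of "F - B 1"] unfolding \<tau>1 by linarith
      then show ?thesis by blast
    qed
    then show "if insert i D = {} then bl.process i s 0 A' = by_type A
        else \<forall>\<tau>\<in>T. bl.process i s 0 A' \<tau> = {}" using D A' by simp
  qed (use p1 in auto)
  then show False using bt(3) by simp
qed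

text \<open>Robustness is refuted by using its witness property twice, for the same type and the
  same block \<open>i\<close>. The resulting \<open>F\<close> and \<open>H\<close> are disjoint
  outside block \<open>i\<close>, and the spread layout provides the counting condition under which
  stability makes them disjoint in block \<open>i\<close> as well.\<close>

lemma stable_maximum_many_blocks:
  assumes p2: "2 \<le> p" and A: "maximum_intersecting \<G> A" "stable A" "A \<noteq> {}"
  shows "\<exists>i\<in>I. \<forall>F\<in>A. first i \<in> F"
proof (rule ccontr)
  assume "\<not> ?thesis"
  then have avoid: "\<exists>F\<in>A. first i \<notin> F" if "i \<in> I" for i using that by blast
  have A\<G>: "A \<subseteq> \<G>" and int: "intersecting A" using A by (auto simp: maximum_intersecting_def)
  \<comment> \<open>The doubled room that \<open>spread_exists\<close> asks for; this is where
    \<open>p \<ge> 2\<close> enters.\<close>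
  have n6: "6 * b i \<le> card (B i)" if "i \<in> I" for i
  proof -
    have "2 * (3 * b i) \<le> p * (3 * b i)" using p2 by (rule mult_le_mono1)
    moreover have "p * (3 * b i) \<le> card (B i)" using b_le[OF that] by (simp only: mult_ac)
    ultimately show ?thesis by linarith
  qed
  have "\<exists>\<pi>. spread (card (B i)) (b i) \<pi>" if i: "i \<in> I" for i
    by (rule spread_exists[OF card_B_pos[OF i] n6[OF i]])
  then obtain \<pi> where \<pi>: "\<And>i. i \<in> I \<Longrightarrow> spread (card (B i)) (b i) (\<pi> i)" by metis
  define \<sigma> where "\<sigma> i = inv_into (B i) rk \<circ> \<pi> i" for i
  have \<sigma>: "bij_betw (\<sigma> i) {..<card (B i)} (B i)" "\<And>t. t < card (B i) \<Longrightarrow> rk (\<sigma> i t) = \<pi> i t" if "i \<in> I" for i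
    using layout_bij[OF that, of "\<pi> i"] \<pi>[OF that] unfolding \<sigma>_def spread_def by auto
  have bax: "blocks I B first T (\<lambda>\<tau>. \<tau>) b \<sigma>" using \<sigma> by (intro blocks_axioms) auto
  interpret bl: blocks I B first T "\<lambda>\<tau>. \<tau>" b \<sigma> by (rule bax)
  note bt = by_type_facts[OF bax A\<G> int]
  have rk_arc: "rk ` \<sigma> i ` arc (card (B i)) t m = \<pi> i ` arc (card (B i)) t m" if i: "i \<in> I" for i t m
  proof -
    have "rk (\<sigma> i u) = \<pi> i u" if "u \<in> arc (card (B i)) t m" for u
      using \<sigma>(2)[OF i] arc_subset[OF card_B_pos[OF i]] that by blast
    then show ?thesis unfolding image_image by (intro image_cong) auto
  qed
  have \<tau>b: "\<tau> j \<le> b j" if "\<tau> \<in> T" "j \<in> I" for \<tau> j using bl.\<kappa>_le[OF that] .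
  have adm_low: "bl.admissible j m {y \<in> B j. rk y < b j}" if j: "j \<in> I" and m: "m \<le> b j" for j m
  proof -
    have "{t. t < card (B j) \<and> \<sigma> j ` arc (card (B j)) t m \<inter> {y \<in> B j. rk y < b j} \<noteq> {}}
        \<subseteq> {t. t < card (B j) \<and> \<pi> j ` arc (card (B j)) t m \<inter> {..<b j} \<noteq> {}}"
    proof
      fix t assume "t \<in> {t. t < card (B j) \<and> \<sigma> j ` arc (card (B j)) t m \<inter> {y \<in> B j. rk y < b j} \<noteq> {}}"
      then obtain y where y: "t < card (B j)" "y \<in> \<sigma> j ` arc (card (B j)) t m" "rk y < b j" by blast
      then have "rk y \<in> \<pi> j ` arc (card (B j)) t m \<inter> {..<b j}" unfolding rk_arc[OF j, symmetric] by blast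
      then show "t \<in> {t. t < card (B j) \<and> \<pi> j ` arc (card (B j)) t m \<inter> {..<b j} \<noteq> {}}" using y(1) by blast
    qed
    then have "card {t. t < card (B j) \<and> \<sigma> j ` arc (card (B j)) t m \<inter> {y \<in> B j. rk y < b j} \<noteq> {}}
        \<le> card {t. t < card (B j) \<and> \<pi> j ` arc (card (B j)) t m \<inter> {..<b j} \<noteq> {}}"
      by (intro card_mono) auto
    then show ?thesis using \<pi>[OF j] m unfolding bl.admissible_def spread_def by (meson le_less_trans)
  qed
  have adm_arc: "bl.admissible j m (\<sigma> j ` arc (card (B j)) t m)" if j: "j \<in> I" and m: "m \<le> b j" for j m t
  proof -
    have sub: "arc (card (B j)) u m \<subseteq> {..<card (B j)}" for u using arc_subset[OF card_B_pos[OF j]] .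
    have "\<sigma> j ` arc (card (B j)) u m \<inter> \<sigma> j ` arc (card (B j)) t m = {}
        \<longleftrightarrow> arc (card (B j)) u m \<inter> arc (card (B j)) t m = {}" for u
      using inj_on_image_Int[of "\<sigma> j" "{..<card (B j)}", OF _ sub sub, of u t] \<sigma>(1)[OF j]
      by (auto simp: bij_betw_def)
    then have "card {u. u < card (B j) \<and> \<sigma> j ` arc (card (B j)) u m \<inter> \<sigma> j ` arc (card (B j)) t m \<noteq> {}} \<le> m + m - 1"
      using card_meeting_arcs[OF card_B_pos[OF j], of m t m] by simp
    then show ?thesis using m n6[OF j] card_B_pos[OF j] unfolding bl.admissible_def by linarith
  qed
  have "\<not> bl.robust {} (by_type A)"
  proof
    assume "bl.robust {} (by_type A)"
    then obtain \<tau> i where \<tau>i: "\<tau> \<in> T" "i \<in> I" and ex: "\<And>Q. \<forall>j\<in>I. bl.admissible j (\<tau> j) (Q j) \<Longrightarrow>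
        \<exists>F\<in>by_type A \<tau>. bl.spread_member {} \<tau> i Q F"
      unfolding bl.robust_def by blast
    let ?n = "card (B i)"
    obtain F0 where F0: "F0 \<in> A" "first i \<notin> F0" using avoid[OF \<tau>i(2)] by blast
    obtain G where G: "G \<in> A" "\<And>j y. j \<in> I \<Longrightarrow> j \<noteq> i \<Longrightarrow> y \<in> G \<inter> B j \<Longrightarrow> rk y < b j"
        "\<And>y. y \<in> G \<inter> B i \<Longrightarrow> 1 \<le> rk y \<and> rk y \<le> card (G \<inter> B i)"
      using stable_compressed_member[OF A(2) A\<G> \<tau>i(2) F0] by blast
    \<comment> \<open>Avoiding low ranks in the other blocks makes \<open>F\<close> disjoint there
      from the compressed member \<open>G\<close>.\<close>
    obtain F where F: "F \<in> by_type A \<tau>" "bl.spread_member {} \<tau> i (\<lambda>j. {y \<in> B j. rk y < b j}) F"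
      using ex[of "\<lambda>j. {y \<in> B j. rk y < b j}"] adm_low \<tau>b[OF \<tau>i(1)] by blast
    have FA: "F \<in> A" using F by (simp add: by_type_def)
    have Farc: "\<exists>t<card (B j). F \<inter> B j = \<sigma> j ` arc (card (B j)) t (\<tau> j)" if "j \<in> I" for j
      using F(2) that unfolding bl.spread_member_def by auto
    have Flow: "F \<inter> B j \<inter> {y \<in> B j. rk y < b j} = {}" if "j \<in> I" "j \<noteq> i" for j
      using F(2) that unfolding bl.spread_member_def by auto
    have "bl.admissible j (\<tau> j) (F \<inter> B j)" if "j \<in> I" for j
      using Farc[OF that] adm_arc[OF that \<tau>b[OF \<tau>i(1) that]] by metis
    \<comment> \<open>The forbidden sets may now depend on \<open>F\<close>, because the type and
      \<open>i\<close> were fixed before \<open>Q\<close>.\<close>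
    then obtain H where H: "H \<in> by_type A \<tau>" "bl.spread_member {} \<tau> i (\<lambda>j. F \<inter> B j) H"
      using ex[of "\<lambda>j. F \<inter> B j"] by blast
    have HA: "H \<in> A" using H by (simp add: by_type_def)
    have Hdis: "H \<inter> B j \<inter> F = {}" if "j \<in> I" "j \<noteq> i" for j
      using H(2) that unfolding bl.spread_member_def by auto
    have Fi: "\<exists>t<?n. F \<inter> B i = \<sigma> i ` arc ?n t (\<tau> i)" using Farc[OF \<tau>i(2)] .
    have Hi: "\<exists>t<?n. H \<inter> B i = \<sigma> i ` arc ?n t (\<tau> i)"
      using H(2) \<tau>i(2) unfolding bl.spread_member_def by auto
    obtain tF where tF: "F \<inter> B i = \<sigma> i ` arc ?n tF (\<tau> i)" using Fi by blast
    obtain tH where tH: "H \<inter> B i = \<sigma> i ` arc ?n tH (\<tau> i)" using Hi by blast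
    have cF: "card {y \<in> F \<inter> B i. rk y < m} = card (\<pi> i ` arc ?n tF (\<tau> i) \<inter> {..<m})" for m
    proof -
      have "rk ` {y \<in> F \<inter> B i. rk y < m} = \<pi> i ` arc ?n tF (\<tau> i) \<inter> {..<m}"
        unfolding rk_arc[OF \<tau>i(2), symmetric] tF[symmetric] by auto
      moreover have "card (rk ` {y \<in> F \<inter> B i. rk y < m}) = card {y \<in> F \<inter> B i. rk y < m}"
        by (intro card_rk_image[OF \<tau>i(2)]) blast
      ultimately show ?thesis by (simp only:)
    qed
    have cH: "card {y \<in> H \<inter> B i. rk y < m} = card (\<pi> i ` arc ?n tH (\<tau> i) \<inter> {..<m})" for m
    proof -
      have "rk ` {y \<in> H \<inter> B i. rk y < m} = \<pi> i ` arc ?n tH (\<tau> i) \<inter> {..<m}"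
        unfolding rk_arc[OF \<tau>i(2), symmetric] tH[symmetric] by auto
      moreover have "card (rk ` {y \<in> H \<inter> B i. rk y < m}) = card {y \<in> H \<inter> B i. rk y < m}"
        by (intro card_rk_image[OF \<tau>i(2)]) blast
      ultimately show ?thesis by (simp only:)
    qed
    have \<tau>bi: "\<tau> i \<le> b i" using \<tau>b[OF \<tau>i] .
    have far: "\<pi> i ` arc ?n t (\<tau> i) \<inter> {1..2 * b i} = {}" if "0 \<in> \<pi> i ` arc ?n t (\<tau> i)" for t
      using \<pi>[OF \<tau>i(2)] \<tau>bi that unfolding spread_def by blast
    have half: "2 * card (\<pi> i ` arc ?n t (\<tau> i) \<inter> {..<m}) \<le> m" if "0 \<notin> \<pi> i ` arc ?n t (\<tau> i)" for t m
      using \<pi>[OF \<tau>i(2)] \<tau>bi that unfolding spread_def by blast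
    \<comment> \<open>\<open>F\<close> can meet \<open>G\<close> only in block \<open>i\<close>,
      where \<open>G\<close> has ranks from 1 to \<open>b i\<close>. An arc through rank 0 contains
      none of these.\<close>
    have F0: "0 \<notin> \<pi> i ` arc ?n tF (\<tau> i)"
    proof
      assume z: "0 \<in> \<pi> i ` arc ?n tF (\<tau> i)"
      have "G \<inter> F \<noteq> {}" using int G(1) FA by (auto simp: intersecting_def)
      then obtain y where y: "y \<in> G" "y \<in> F" by blast
      have "y \<in> X" using y FA A\<G> \<G>_iff by blast
      then obtain j where j: "j \<in> I" "y \<in> B j" by (auto simp: X_def)
      have ji: "j = i"
      proof (rule ccontr)
        assume "j \<noteq> i"
        then show False using Flow[OF j(1)] G(2)[OF j(1), of y] y j by blast
      qed
      have "card (G \<inter> B i) \<le> b i" using card_block_le[OF _ \<tau>i(2)] G(1) A\<G> by blast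
      then have r: "rk y \<in> {1..2 * b i}" using G(3)[of y] y j ji by auto
      have "rk y \<in> \<pi> i ` arc ?n tF (\<tau> i)"
        unfolding rk_arc[OF \<tau>i(2), symmetric] tF[symmetric] using y j ji by blast
      then show False using far[OF z] r by blast
    qed
    have card_le: "card (\<pi> i ` arc ?n t (\<tau> i) \<inter> {..<m}) \<le> b i" for t m
    proof -
      have fin: "finite (arc ?n t (\<tau> i))" by (simp add: arc_def)
      have "card (\<pi> i ` arc ?n t (\<tau> i) \<inter> {..<m}) \<le> card (\<pi> i ` arc ?n t (\<tau> i))"
        using fin by (intro card_mono) auto
      also have "\<dots> \<le> card (arc ?n t (\<tau> i))" using fin by (rule card_image_le)
      also have "\<dots> = \<tau> i" using n6[OF \<tau>i(2)] \<tau>bi by (intro card_arc) linarith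
      finally show ?thesis using \<tau>bi by simp
    qed
    \<comment> \<open>If the arc of \<open>H\<close> avoids rank 0, each set has at most half of the
      ranks below \<open>m\<close>. If it contains rank 0, that is its only rank up to
      \<open>2 * b i\<close>, and one plus half of \<open>m\<close>, rounded down, is at most
      \<open>m\<close> for \<open>m \<ge> 1\<close>; beyond that, both traces together have at most
      \<open>2 * b i\<close> elements.\<close>
    have count: "card {y \<in> F \<inter> B i. rk y < m} + card {y \<in> H \<inter> B i. rk y < m} \<le> m" for m
    proof (cases "0 \<in> \<pi> i ` arc ?n tH (\<tau> i)")
      case False
      then show ?thesis unfolding cF cH using half[OF F0, of m] half[OF False, of m] by linarith
    next
      case True
      consider "m = 0" | "1 \<le> m" "m \<le> 2 * b i + 1" | "2 * b i < m" by linarith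
      then show ?thesis
      proof cases
        case 2
        have "\<pi> i ` arc ?n tH (\<tau> i) \<inter> {..<m} \<subseteq> {0}"
        proof
          fix r assume r: "r \<in> \<pi> i ` arc ?n tH (\<tau> i) \<inter> {..<m}"
          then have "r \<notin> {1..2 * b i}" using far[OF True] by blast
          moreover have "r < m" using r by blast
          ultimately show "r \<in> {0}" using 2 by auto
        qed
        then have "card (\<pi> i ` arc ?n tH (\<tau> i) \<inter> {..<m}) \<le> card {0::nat}" by (intro card_mono) auto
        then show ?thesis unfolding cF cH using half[OF F0, of m] 2 by simp
      next
        case 3
        then show ?thesis unfolding cF cH using card_le[of tF m] card_le[of tH m] by linarith
      qed simp
    qed
    obtain H' where H': "H' \<in> A" "H' - B i = H - B i" "F \<inter> H' \<inter> B i = {}"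
      using stable_make_disjoint[OF A(2) A\<G> \<tau>i(2) FA HA count] by blast
    have "F \<inter> H' = {}"
    proof (rule ccontr)
      assume "F \<inter> H' \<noteq> {}"
      then obtain y where y: "y \<in> F" "y \<in> H'" by blast
      have "y \<in> X" using y FA A\<G> \<G>_iff by blast
      then obtain j where j: "j \<in> I" "y \<in> B j" by (auto simp: X_def)
      show False
      proof (cases "j = i")
        case True
        then show ?thesis using H'(3) y j by blast
      next
        case False
        then have "y \<notin> B i" using blocks_disjoint[OF j(1) \<tau>i(2)] j by blast
        then have "y \<in> H" using H'(2) y by blast
        then show ?thesis using Hdis[OF j(1) False] y j by blast
      qed
    qed
    then show False using int FA H'(1) by (auto simp: intersecting_def)
  qed
  then have "bl.W {} (by_type A) < card A"
  proof (rule bl.W_less_not_robust[OF bt(1,2)])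
    show "bl.star_weight i \<le> real (card A)" if "i \<in> I" for i
      unfolding bl.star_weight_def using star_weight_le[OF A(1) that] by simp
    show "0 < real (card A)" using A(3) finite_subset[OF A\<G> finite_\<G>] by (simp add: card_gt_0_iff)
  qed
  then show False using bt(3) by simp
qed

text \<open>An unstable family is shifted, which lowers its total potential. Induction makes the
  shifted family a star, and \<open>star_of_shift_star\<close> carries this back.\<close>

lemma maximum_intersecting_full_star:
  assumes "maximum_intersecting \<G> A"
  shows "full_1_star X \<G> A"
  using assms
proof (induction "\<Sum>F\<in>A. potential F" arbitrary: A rule: less_induct)
  case (less A)
  have A\<G>: "A \<subseteq> \<G>" using less by (auto simp: maximum_intersecting_def)
  have finA: "finite A" using A\<G> finite_\<G> finite_subset by blast
  show ?case
  proof (cases "stable A")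
    case True
    have "\<exists>i\<in>I. \<forall>F\<in>A. first i \<in> F"
    proof (cases "A = {}")
      case True
      then show ?thesis using p by auto
    next
      case False
      show ?thesis
      proof (cases "p = 1")
        case True
        then show ?thesis using stable_maximum_single_block[OF True less(2) \<open>stable A\<close> False] by auto
      next
        case neq: False
        then have "2 \<le> p" using p by linarith
        then show ?thesis using stable_maximum_many_blocks[OF _ less(2) \<open>stable A\<close> False] by blast
      qed
    qed
    then obtain i where i: "i \<in> I" "\<And>F. F \<in> A \<Longrightarrow> first i \<in> F" by blast
    then show ?thesis using maximum_star[OF less(2) i(2)] first[OF i(1)] block_subset[OF i(1)]
      unfolding full_1_star_def by blast
  next
    case False
    then obtain F i u v where F: "F \<in> A" "i \<in> I" "u \<in> B i" "v \<in> B i" "rk u < rk v" "v \<in> F" "u \<notin> F"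
        "insert u (F - {v}) \<notin> A"
      unfolding stable_def by blast
    then have uv: "u \<noteq> v" by auto
    note max = shift_maximum[OF less(2) F(2-4) uv]
    have le: "potential (shift u v A H) \<le> potential H" if "H \<in> A" for H
      using potential_shift[OF finite_member, of H v u] that A\<G> F(5) by (auto simp: shift_def)
    have "potential (shift u v A F) < potential F"
      using potential_shift[OF finite_member, of F v u] A\<G> F by (auto simp: shift_def)
    then have "(\<Sum>H\<in>A. potential (shift u v A H)) < (\<Sum>H\<in>A. potential H)"
      using finA le F(1) by (intro sum_strict_mono_ex1) auto
    then have "(\<Sum>H\<in>shift u v A ` A. potential H) < (\<Sum>H\<in>A. potential H)"
      by (simp add: sum.reindex[OF shift_inj[OF uv]])
    from less(1)[OF this max] obtain z where z: "z \<in> X" "shift u v A ` A = {F \<in> \<G>. z \<in> F}"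
      unfolding full_1_star_def by blast
    show ?thesis by (rule star_of_shift_star[OF less(2) F(2-4) uv z])
  qed
qed

end

theorem corollary1p3:
  fixes p k :: nat and X :: "'a set" and B :: "nat \<Rightarrow> 'a set" and a :: "nat \<Rightarrow> nat"
    and \<F> :: "'a set set"
  assumes "p \<ge> 1"
    and "finite X"
    and "X = (\<Union>i\<in>{1..p}. B i)"
    and "disjoint_family_on B {1..p}"
    and "\<And>i. i \<in> {1..p} \<Longrightarrow> B i \<noteq> {}"
    and "\<And>i. i \<in> {1..p} \<Longrightarrow> a i < card (B i)"
    and "1 \<le> k" and "k \<le> card X"
    and "(\<Sum>i\<in>{1..p}. a i) \<le> k"
    and "\<And>i. i \<in> {1..p} \<Longrightarrow>
           int (card (B i)) \<ge> 3 * int p * (int k - int (\<Sum>j\<in>{1..p}. a j) + int (a i))"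
    and "maximum_intersecting (bounded_family p B a k) \<F>"
  shows "full_1_star X (bounded_family p B a k) \<F>"
proof -
  have fin: "finite (B i)" if "i \<in> {1..p}" for i
    using assms(2,3) that by (auto intro: finite_subset)
  have "\<exists>h. bij_betw h (B i) {..<card (B i)}" if "i \<in> {1..p}" for i
    using ex_bij_betw_finite_nat[OF fin[OF that]] by (simp add: lessThan_atLeast0)
  then obtain h where h: "\<And>i. i \<in> {1..p} \<Longrightarrow> bij_betw (h i) (B i) {..<card (B i)}" by metis
  \<comment> \<open>The blocks are disjoint, so the rankings of the single blocks combine into one
    function.\<close>
  define rk where "rk y = h (THE i. i \<in> {1..p} \<and> y \<in> B i) y" for y
  have rk: "rk y = h i y" if "i \<in> {1..p}" "y \<in> B i" for i y
  proof -
    have "(THE i. i \<in> {1..p} \<and> y \<in> B i) = i"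
    proof (rule the_equality)
      show "i \<in> {1..p} \<and> y \<in> B i" using that by blast
      fix j assume j: "j \<in> {1..p} \<and> y \<in> B j"
      show "j = i"
      proof (rule ccontr)
        assume "j \<noteq> i"
        then have "B j \<inter> B i = {}" using disjoint_family_onD[OF assms(4)] j that by blast
        then show False using j that by blast
      qed
    qed
    then show ?thesis by (simp add: rk_def)
  qed
  interpret quota p k B a rk
  proof
    show "3 * p * (k - (\<Sum>j\<in>{1..p}. a j) + a i) \<le> card (B i)" if "i \<in> {1..p}" for i
    proof -
      \<comment> \<open>The difference in the hypothesis is an integer; \<open>of_nat_diff\<close>
        applies because the quotas sum to at most \<open>k\<close>, so the subtraction on naturals
        is exact.\<close>
      have "int (3 * p * (k - (\<Sum>j\<in>{1..p}. a j) + a i)) \<le> int (card (B i))"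
        using assms(10)[OF that] of_nat_diff[OF assms(9), where ?'a = int]
        by (simp only: of_nat_mult of_nat_add of_nat_numeral)
      then show ?thesis by linarith
    qed
    show "bij_betw rk (B i) {..<card (B i)}" if "i \<in> {1..p}" for i
      using h[OF that] bij_betw_cong[of "B i" rk "h i"] rk[OF that] by blast
  qed (use assms fin in auto)
  show ?thesis using maximum_intersecting_full_star[OF assms(11)] assms(3) by (simp add: X_def)
qed

end
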